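(* Let $1\le k\le 2n$, let $\Omega\subset\mathbb{H}^n$ be open and let $f:\Omega\to\mathbb{R}^k$ be of class $C^1$ with surjective differential at each point of $\Omega$. Let $\Sigma=f^{-1}(0)$, a submanifold of $\Omega$ of dimension $p=2n+1-k$, and let $x\in\Sigma$. Then $$|\tau_{\Sigma,\mathcal V}(x)|=\frac{J_Hf(x)}{J_gf(x)}.$$
   Context: Heisenberg group: $\mathbb{H}^n$ is the simply connected Lie group of dimension $2n+1$ whose Lie algebra (identified with left invariant vector fields) has a basis $(X_1,\dots,X_{2n},Z)$ whose only nontrivial brackets are $[X_k,X_{k+n}]=2Z$, $k=1,\dots,n$. The horizontal space is $H_x\mathbb{H}^n=\mathrm{span}\{X_1(x),\dots,X_{2n}(x)\}$. The Riemannian metric $g$ is the left invariant one making $(X_1,\dots,X_{2n},Z)$ orthonormal. Jacobians: $J_gf(x)=\|\Lambda_k(df(x))\|$ is the norm of the induced map $\Lambda_k(T_x\mathbb{H}^n)\to\Lambda_k(\mathbb{R}^k)$, i.e. the square root of the sum of the squares of all $k\times k$ minors of the matrix of $df(x)$ with respect to a $g$-orthonormal basis of $T_x\mathbb{H}^n$ and an orthonormal basis of $\mathbb{R}^k$. The horizontal jacobian is $J_Hf(x)=\|\Lambda_k(df(x)_{|H_x\mathbb{H}^n})\|$, i.e. the square root of the sum of the squares of all $k\times k$ minors of the $k\times 2n$ matrix $(X_jf^i(x))$. The spaces $\Lambda_p(T_x\mathbb{H}^n)$ carry the scalar product $\langle v_1\wedge\dots\wedge v_p,w_1\wedge\dots\wedge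 w_p\rangle=\det\big(g(x)(v_i,w_j)\big)$. Vertical $p$-vectors at $x$ are linear combinations of $X_{j_1}(x)\wedge\dots\wedge X_{j_{p-1}}(x)\wedge Z(x)$, $1\le j_s\le 2n$; they form the orthogonal complement $\mathcal V_p(T_x\mathbb{H}^n)$ of $\Lambda_p(H_x\mathbb{H}^n)$, and $\pi_{\mathcal V}$ is the orthogonal projection onto it. A tangent $p$-vector is $\tau_\Sigma(x)=t_1\wedge\dots\wedge t_p$ with $(t_1,\dots,t_p)$ an orthonormal basis of $T_x\Sigma$ (defined up to sign), and $\tau_{\Sigma,\mathcal V}(x)=\pi_{\mathcal V}(\tau_\Sigma(x))$. *)

theory Defs
  imports "HOL-Analysis.Analysis"
begin

subsection \<open>The Heisenberg group\<close>

text \<open>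
  Exponential coordinates \<open>(a, b, c)\<close>, dual to \<open>(X\<^sub>1,\<dots>,X\<^sub>n)\<close>, \<open>(X\<^bsub>n+1\<^esub>,\<dots>,X\<^bsub>2n\<^esub>)\<close> and \<open>Z\<close>
  at the identity \<open>0\<close>. The Baker-Campbell-Hausdorff formula for the brackets
  \<open>[X\<^sub>k, X\<^bsub>k+n\<^esub>] = 2 Z\<close> gives the product below (see \<open>heis_brackets\<close>). Every tangent space
  is identified with the coordinate space itself.
\<close>

type_synonym 'n heis = "(real^'n) \<times> (real^'n) \<times> real"

definition heis_mult :: "'n::finite heis \<Rightarrow> 'n heis \<Rightarrow> 'n heis" where
  "heis_mult p q = (case p of (a, b, c) \<Rightarrow> case q of (a', b', c') \<Rightarrow>
     (a + a', b + b', c + c' + (a \<bullet> b' - b \<bullet> a')))"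

definition heis_inv :: "'n::finite heis \<Rightarrow> 'n heis" where
  "heis_inv p = - p"

lemma heis_mult_assoc: "heis_mult (heis_mult p q) r = heis_mult p (heis_mult q r)"
  by (auto simp: heis_mult_def inner_simps split: prod.splits)

lemma heis_mult_0: "heis_mult 0 p = p" "heis_mult p 0 = p"
  by (auto simp: heis_mult_def zero_prod_def split: prod.splits)

lemma heis_mult_inv: "heis_mult (heis_inv p) p = 0" "heis_mult p (heis_inv p) = 0"
  by (auto simp: heis_mult_def heis_inv_def zero_prod_def inner_commute split: prod.splits)

definition left_inv_field :: "'n::finite heis \<Rightarrow> 'n heis \<Rightarrow> 'n heis" where
  "left_inv_field e p = frechet_derivative (heis_mult p) (at 0) e"

text \<open>\<open>hor_field (Inl k)\<close> is \<open>X\<^sub>k\<close> and \<open>hor_field (Inr k)\<close> is \<open>X\<^bsub>k+n\<^esub>\<close>.\<close>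

definition hor_field :: "'n::finite + 'n \<Rightarrow> 'n heis \<Rightarrow> 'n heis" where
  "hor_field j = left_inv_field (case j of Inl k \<Rightarrow> (axis k 1, 0, 0) | Inr k \<Rightarrow> (0, axis k 1, 0))"

definition Z_field :: "'n::finite heis \<Rightarrow> 'n heis" where
  "Z_field = left_inv_field (0, 0, 1)"

definition heis_frame :: "('n::finite + 'n) option \<Rightarrow> 'n heis \<Rightarrow> 'n heis" where
  "heis_frame m = (case m of None \<Rightarrow> Z_field | Some j \<Rightarrow> hor_field j)"

definition heis_metric :: "'n::finite heis \<Rightarrow> 'n heis \<Rightarrow> 'n heis \<Rightarrow> real" where
  "heis_metric p v w =
     frechet_derivative (heis_mult (heis_inv p)) (at p) v \<bullet>
     frechet_derivative (heis_mult (heis_inv p)) (at p) w"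

lemma has_derivative_heis_mult:
  "(heis_mult p has_derivative
     (\<lambda>v. (fst v, fst (snd v), snd (snd v) + (fst p \<bullet> fst (snd v) - fst (snd p) \<bullet> fst v)))) (at q)"
proof -
  have "heis_mult p = (\<lambda>q. (fst p + fst q, fst (snd p) + fst (snd q),
      snd (snd p) + snd (snd q) + (fst p \<bullet> fst (snd q) - fst (snd p) \<bullet> fst q)))"
    by (auto simp: heis_mult_def fun_eq_iff split: prod.splits)
  then show ?thesis
    by (auto intro!: derivative_eq_intros)
qed

lemmas frechet_derivative_heis_mult =
  frechet_derivative_at[OF has_derivative_heis_mult, symmetric]

lemma hor_field_Inl: "hor_field (Inl k) p = (axis k 1, 0, - (fst (snd p) $ k))"
  by (simp add: hor_field_def left_inv_field_def frechet_derivative_heis_mult inner_axis)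

lemma hor_field_Inr: "hor_field (Inr k) p = (0, axis k 1, fst p $ k)"
  by (simp add: hor_field_def left_inv_field_def frechet_derivative_heis_mult inner_axis)

lemma Z_field: "Z_field p = (0, 0, 1)"
  by (simp add: Z_field_def left_inv_field_def frechet_derivative_heis_mult)

lemma heis_metric_eq:
  "heis_metric p v w = fst v \<bullet> fst w + fst (snd v) \<bullet> fst (snd w) +
     (snd (snd v) - (fst p \<bullet> fst (snd v) - fst (snd p) \<bullet> fst v)) *
     (snd (snd w) - (fst p \<bullet> fst (snd w) - fst (snd p) \<bullet> fst w))"
  by (simp add: heis_metric_def frechet_derivative_heis_mult heis_inv_def inner_prod_def
      algebra_simps)

lemma heis_metric_frame: "heis_metric p (heis_frame i p) (heis_frame j p) = (if i = j then 1 else 0)"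
proof -
  have "heis_metric p (hor_field a p) (hor_field b p) = (if a = b then 1 else 0)" for a b
    by (cases a; cases b)
       (simp_all add: heis_metric_eq hor_field_Inl hor_field_Inr inner_axis inner_axis_axis, simp_all add: axis_def)
  moreover have "heis_metric p (hor_field a p) (Z_field p) = 0"
    "heis_metric p (Z_field p) (hor_field a p) = 0" for a
    by (cases a; simp add: heis_metric_eq hor_field_Inl hor_field_Inr Z_field inner_axis)+
  moreover have "heis_metric p (Z_field p) (Z_field p) = 1"
    by (simp add: heis_metric_eq Z_field)
  ultimately show ?thesis
    by (auto simp: heis_frame_def split: option.splits)
qed

definition lie_bracket :: "('a::real_normed_vector \<Rightarrow> 'a) \<Rightarrow> ('a \<Rightarrow> 'a) \<Rightarrow> 'a \<Rightarrow> 'a" where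
  "lie_bracket U V p = frechet_derivative V (at p) (U p) - frechet_derivative U (at p) (V p)"

lemma heis_brackets:
  "lie_bracket (hor_field (Inl k)) (hor_field (Inr l)) p = (if k = l then 2 *\<^sub>R Z_field p else 0)"
  "lie_bracket (hor_field (Inl k)) (hor_field (Inl l)) p = 0"
  "lie_bracket (hor_field (Inr k)) (hor_field (Inr l)) p = 0"
  "lie_bracket (hor_field j) Z_field p = 0"
proof -
  have l: "frechet_derivative (hor_field (Inl k)) (at p) = (\<lambda>v. (0, 0, - (fst (snd v) $ k)))" for k p
  proof -
    have "(hor_field (Inl k) has_derivative (\<lambda>v. (0, 0, - (fst (snd v) $ k)))) (at p)"
      unfolding hor_field_Inl[abs_def]
      by (auto intro!: derivative_eq_intros bounded_linear.has_derivative[OF bounded_linear_vec_nth])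
    then show ?thesis by (rule frechet_derivative_at[symmetric])
  qed
  have r: "frechet_derivative (hor_field (Inr k)) (at p) = (\<lambda>v. (0, 0, fst v $ k))" for k p
  proof -
    have "(hor_field (Inr k) has_derivative (\<lambda>v. (0, 0, fst v $ k))) (at p)"
      unfolding hor_field_Inr[abs_def]
      by (auto intro!: derivative_eq_intros bounded_linear.has_derivative[OF bounded_linear_vec_nth])
    then show ?thesis by (rule frechet_derivative_at[symmetric])
  qed
  have z: "frechet_derivative Z_field (at p) = (\<lambda>v. 0)" for p
    unfolding Z_field[abs_def] by simp
  show
    "lie_bracket (hor_field (Inl k)) (hor_field (Inr l)) p = (if k = l then 2 *\<^sub>R Z_field p else 0)"
    "lie_bracket (hor_field (Inl k)) (hor_field (Inl l)) p = 0"
    "lie_bracket (hor_field (Inr k)) (hor_field (Inr l)) p = 0"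
    by (auto simp: lie_bracket_def l r hor_field_Inl hor_field_Inr Z_field axis_def zero_prod_def)
  show "lie_bracket (hor_field j) Z_field p = 0"
    by (cases j) (auto simp: lie_bracket_def l r z Z_field zero_prod_def)
qed


subsection \<open>Multivectors\<close>

text \<open>
  A \<open>p\<close>-tuple is a family indexed by a finite type \<open>'p\<close> with \<open>CARD('p) = p\<close>. The space
  \<open>\<Lambda>\<^sub>p(V)\<close> is realised as the span of the evaluations \<open>\<omega> \<mapsto> \<omega>(v\<^sub>1,\<dots>,v\<^sub>p)\<close> on
  alternating \<open>p\<close>-linear forms, the evaluation at \<open>v\<close> being \<open>v\<^sub>1 \<and> \<dots> \<and> v\<^sub>p\<close>.
\<close>

definition alternating :: "(('p \<Rightarrow> 'v::real_vector) \<Rightarrow> real) \<Rightarrow> bool" where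
  "alternating \<omega> \<longleftrightarrow> (\<forall>v i. linear (\<lambda>u. \<omega> (v(i := u)))) \<and>
     (\<forall>v i j. i \<noteq> j \<longrightarrow> v i = v j \<longrightarrow> \<omega> v = 0)"

lemma alternating_0: "alternating (\<lambda>v. 0)"
  by (simp add: alternating_def linear_zero)

lemma alternating_add:
  "alternating \<omega> \<Longrightarrow> alternating \<eta> \<Longrightarrow> alternating (\<lambda>v. \<omega> v + \<eta> v)"
  by (auto simp: alternating_def intro!: linear_compose_add)

lemma alternating_scale: "alternating \<omega> \<Longrightarrow> alternating (\<lambda>v. c * \<omega> v)"
  using linear_compose_scale_right[where 'b = real]
  by (auto simp: alternating_def)

lemma alternating_sum:
  "(\<And>a. a \<in> A \<Longrightarrow> alternating (\<omega> a)) \<Longrightarrow> alternating (\<lambda>v. \<Sum>a\<in>A. \<omega> a v)"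
  by (induction A rule: infinite_finite_induct) (auto intro: alternating_0 alternating_add)

typedef (overloaded) ('p, 'v) alt_form = "{\<omega> :: ('p \<Rightarrow> 'v::real_vector) \<Rightarrow> real. alternating \<omega>}"
  by (rule exI[of _ "\<lambda>v. 0"]) (simp add: alternating_0)

typedef (overloaded) ('p, 'v) pvector =
  "{\<xi> :: ('p, 'v::real_vector) alt_form \<Rightarrow> real.
      \<exists>A c. finite A \<and> \<xi> = (\<lambda>\<omega>. \<Sum>v\<in>A. c v * Rep_alt_form \<omega> v)}"
  by (rule exI[of _ "\<lambda>\<omega>. 0"], simp, rule exI[of _ "{}"], simp)

lemma Rep_pvectorE:
  obtains A c where "finite A" "Rep_pvector \<xi> = (\<lambda>\<omega>. \<Sum>v\<in>A. c v * Rep_alt_form \<omega> v)"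
  using Rep_pvector[of \<xi>] by auto

instantiation pvector :: (type, real_vector) real_vector
begin

definition "0 = Abs_pvector (\<lambda>\<omega>. 0)"
definition "\<xi> + \<eta> = Abs_pvector (\<lambda>\<omega>. Rep_pvector \<xi> \<omega> + Rep_pvector \<eta> \<omega>)"
definition "a *\<^sub>R \<xi> = Abs_pvector (\<lambda>\<omega>. a * Rep_pvector \<xi> \<omega>)"
definition "- (\<xi> :: ('a, 'b) pvector) = (-1) *\<^sub>R \<xi>"
definition "\<xi> - \<eta> = \<xi> + - (\<eta> :: ('a, 'b) pvector)"

lemma Rep_pvector_0: "Rep_pvector 0 = (\<lambda>\<omega>. 0)"
  unfolding zero_pvector_def by (rule Abs_pvector_inverse) (auto intro!: exI[of _ "{}"])

lemma Rep_pvector_add: "Rep_pvector (\<xi> + \<eta>) = (\<lambda>\<omega>. Rep_pvector \<xi> \<omega> + Rep_pvector \<eta> \<omega>)"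
  unfolding plus_pvector_def
proof (rule Abs_pvector_inverse)
  obtain A c where A: "finite A" "Rep_pvector \<xi> = (\<lambda>\<omega>. \<Sum>v\<in>A. c v * Rep_alt_form \<omega> v)"
    by (rule Rep_pvectorE)
  obtain B d where B: "finite B" "Rep_pvector \<eta> = (\<lambda>\<omega>. \<Sum>v\<in>B. d v * Rep_alt_form \<omega> v)"
    by (rule Rep_pvectorE)
  let ?e = "\<lambda>v. (if v \<in> A then c v else 0) + (if v \<in> B then d v else 0)"
  have "(\<Sum>v\<in>A \<union> B. ?e v * r v) = (\<Sum>v\<in>A. c v * r v) + (\<Sum>v\<in>B. d v * r v)" for r
  proof -
    have "(\<Sum>v\<in>A. c v * r v) = (\<Sum>v\<in>A \<union> B. (if v \<in> A then c v else 0) * r v)"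
      by (rule sum.mono_neutral_cong_left) (use A B in auto)
    moreover have "(\<Sum>v\<in>B. d v * r v) = (\<Sum>v\<in>A \<union> B. (if v \<in> B then d v else 0) * r v)"
      by (rule sum.mono_neutral_cong_left) (use A B in auto)
    ultimately show ?thesis
      by (simp add: distrib_right sum.distrib)
  qed
  then show "(\<lambda>\<omega>. Rep_pvector \<xi> \<omega> + Rep_pvector \<eta> \<omega>) \<in>
      {\<xi>. \<exists>A c. finite A \<and> \<xi> = (\<lambda>\<omega>. \<Sum>v\<in>A. c v * Rep_alt_form \<omega> v)}"
    using A B by (auto intro!: exI[of _ "A \<union> B"] exI[of _ ?e])
qed

lemma Rep_pvector_scale: "Rep_pvector (a *\<^sub>R \<xi>) = (\<lambda>\<omega>. a * Rep_pvector \<xi> \<omega>)"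
  unfolding scaleR_pvector_def
proof (rule Abs_pvector_inverse)
  obtain A c where A: "finite A" "Rep_pvector \<xi> = (\<lambda>\<omega>. \<Sum>v\<in>A. c v * Rep_alt_form \<omega> v)"
    by (rule Rep_pvectorE)
  then show "(\<lambda>\<omega>. a * Rep_pvector \<xi> \<omega>) \<in>
      {\<xi>. \<exists>A c. finite A \<and> \<xi> = (\<lambda>\<omega>. \<Sum>v\<in>A. c v * Rep_alt_form \<omega> v)}"
    by (auto simp: sum_distrib_left mult.assoc intro!: exI[of _ A] exI[of _ "\<lambda>v. a * c v"])
qed

instance
  by standard
     (auto simp: Rep_pvector_inject[symmetric] Rep_pvector_0 Rep_pvector_add Rep_pvector_scale
        uminus_pvector_def minus_pvector_def algebra_simps)

end

definition wedge :: "('p \<Rightarrow> 'v::real_vector) \<Rightarrow> ('p, 'v) pvector" where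
  "wedge v = Abs_pvector (\<lambda>\<omega>. Rep_alt_form \<omega> v)"

lemma Rep_pvector_wedge: "Rep_pvector (wedge v) = (\<lambda>\<omega>. Rep_alt_form \<omega> v)"
  unfolding wedge_def
  by (rule Abs_pvector_inverse) (auto intro!: exI[of _ "{v}"] exI[of _ "\<lambda>_. 1"])

text \<open>
  The scalar product is the bilinear extension of
  \<open>\<langle>v\<^sub>1\<and>\<dots>\<and>v\<^sub>p, w\<^sub>1\<and>\<dots>\<and>w\<^sub>p\<rangle> = det (g(v\<^sub>i, w\<^sub>j))\<close>: the second argument is turned into the alternating
  form \<open>v \<mapsto> \<langle>v\<^sub>1\<and>\<dots>\<and>v\<^sub>p, \<eta>\<rangle>\<close>, on which the first argument is evaluated; see \<open>pinner_wedge\<close>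
  and \<open>bilinear_pinner\<close>.
\<close>

definition gram_form ::
    "('v::real_vector \<Rightarrow> 'v \<Rightarrow> real) \<Rightarrow> ('p::finite \<Rightarrow> 'v) \<Rightarrow> ('p, 'v) alt_form" where
  "gram_form g v = Abs_alt_form (\<lambda>w. det (\<chi> i j. g (v i) (w j)))"

definition pinner ::
    "('v::real_vector \<Rightarrow> 'v \<Rightarrow> real) \<Rightarrow> ('p::finite, 'v) pvector \<Rightarrow> ('p, 'v) pvector \<Rightarrow> real" where
  "pinner g \<xi> \<eta> = Rep_pvector \<xi> (Abs_alt_form (\<lambda>v. Rep_pvector \<eta> (gram_form g v)))"

definition pnorm :: "('v::real_vector \<Rightarrow> 'v \<Rightarrow> real) \<Rightarrow> ('p::finite, 'v) pvector \<Rightarrow> real" where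
  "pnorm g \<xi> = sqrt (pinner g \<xi> \<xi>)"

definition pproj :: "('v::real_vector \<Rightarrow> 'v \<Rightarrow> real) \<Rightarrow> ('p::finite, 'v) pvector set \<Rightarrow>
    ('p, 'v) pvector \<Rightarrow> ('p, 'v) pvector" where
  "pproj g W \<xi> = (THE \<eta>. \<eta> \<in> W \<and> (\<forall>\<zeta>\<in>W. pinner g (\<xi> - \<eta>) \<zeta> = 0))"

lemma alternating_det_rows:
  fixes w :: "'p::finite \<Rightarrow> 'v::real_vector"
  assumes "\<And>u. linear (\<lambda>v. g v u)"
  shows "alternating (\<lambda>v::'p \<Rightarrow> 'v. det (\<chi> i j. g (v i) (w j)))"
  unfolding alternating_def
proof (intro conjI allI impI)
  fix v :: "'p \<Rightarrow> 'v" and k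
  have row: "(\<chi> i j. g ((v(k := u)) i) (w j)) =
      (\<chi> i. if i = k then (\<chi> j. g u (w j)) else (\<chi> j. g (v i) (w j)))" for u
    by (auto simp: vec_eq_iff)
  show "linear (\<lambda>u. det (\<chi> i j. g ((v(k := u)) i) (w j)))"
  proof (rule linearI)
    fix a b :: 'v and r :: real
    have "(\<chi> j. g (a + b) (w j)) = (\<chi> j. g a (w j)) + (\<chi> j. g b (w j))"
      by (simp add: vec_eq_iff linear_add[OF assms])
    then show "det (\<chi> i j. g ((v(k := a + b)) i) (w j)) =
        det (\<chi> i j. g ((v(k := a)) i) (w j)) + det (\<chi> i j. g ((v(k := b)) i) (w j))"
      unfolding row by (simp only: det_row_add)
    have "(\<chi> j. g (r *\<^sub>R a) (w j)) = r *s (\<chi> j. g a (w j))"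
      by (simp add: vec_eq_iff linear_scale[OF assms])
    then show "det (\<chi> i j. g ((v(k := r *\<^sub>R a)) i) (w j)) =
        r *\<^sub>R det (\<chi> i j. g ((v(k := a)) i) (w j))"
      unfolding row by (simp only: det_row_mul real_scaleR_def)
  qed
next
  fix v :: "'p \<Rightarrow> 'v" and i j :: 'p
  assume "i \<noteq> j" "v i = v j"
  then show "det (\<chi> i j. g (v i) (w j)) = 0"
    by (intro det_identical_rows[of i j]) (auto simp: row_def)
qed

lemma alternating_det_columns:
  fixes v :: "'p::finite \<Rightarrow> 'v::real_vector"
  assumes "\<And>u. linear (g u)"
  shows "alternating (\<lambda>w::'p \<Rightarrow> 'v. det (\<chi> i j. g (v i) (w j)))"
proof -
  have "(\<lambda>w::'p \<Rightarrow> 'v. det (\<chi> i j. g (v i) (w j))) = (\<lambda>w. det (\<chi> i j. g (v j) (w i)))"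
  proof
    fix w :: "'p \<Rightarrow> 'v"
    show "det (\<chi> i j. g (v i) (w j)) = det (\<chi> i j. g (v j) (w i))"
      using det_transpose[of "\<chi> i j. g (v j) (w i)"] by (simp add: transpose_def)
  qed
  then show ?thesis
    using alternating_det_rows[of "\<lambda>a b. g b a" v] assms by metis
qed

lemma Rep_gram_form:
  "bilinear g \<Longrightarrow> Rep_alt_form (gram_form g v) w = det (\<chi> i j. g (v i) (w j))"
  unfolding gram_form_def
  by (subst Abs_alt_form_inverse) (auto intro!: alternating_det_columns simp: bilinear_def)

lemma Rep_flat:
  assumes "bilinear g"
  shows "Rep_alt_form (Abs_alt_form (\<lambda>v. Rep_pvector \<eta> (gram_form g v))) v =
    Rep_pvector \<eta> (gram_form g v)"
proof -
  obtain A c where A: "finite A" "Rep_pvector \<eta> = (\<lambda>\<omega>. \<Sum>v\<in>A. c v * Rep_alt_form \<omega> v)"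
    by (rule Rep_pvectorE)
  have "alternating (\<lambda>v. Rep_pvector \<eta> (gram_form g v))"
    unfolding A Rep_gram_form[OF assms] using assms
    by (intro alternating_sum alternating_scale alternating_det_rows) (simp add: bilinear_def)
  then show ?thesis
    by (simp add: Abs_alt_form_inverse)
qed

lemma pinner_wedge:
  "bilinear g \<Longrightarrow> pinner g (wedge v) (wedge w) = det (\<chi> i j. g (v i) (w j))"
  by (simp add: pinner_def Rep_pvector_wedge[of v] Rep_flat)
     (simp add: Rep_pvector_wedge Rep_gram_form)

lemma bilinear_pinner:
  assumes g: "bilinear g"
  shows "bilinear (pinner g :: ('p::finite, 'v::real_vector) pvector \<Rightarrow> _)"
  unfolding bilinear_def
proof (intro conjI allI)
  fix \<xi> :: "('p, 'v) pvector"
  obtain A c where A: "finite A" "Rep_pvector \<xi> = (\<lambda>\<omega>. \<Sum>v\<in>A. c v * Rep_alt_form \<omega> v)"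
    by (rule Rep_pvectorE)
  show "linear (pinner g \<xi>)"
    by (rule linearI)
       (simp_all add: pinner_def A Rep_flat[OF g], simp_all add: Rep_pvector_add Rep_pvector_scale
         algebra_simps sum.distrib sum_distrib_left)
  show "linear (\<lambda>\<eta>. pinner g \<eta> \<xi>)"
    by (rule linearI) (simp_all add: pinner_def Rep_pvector_add Rep_pvector_scale)
qed


subsection \<open>Jacobians\<close>

definition C1_on :: "('a::real_normed_vector \<Rightarrow> 'b::real_normed_vector) \<Rightarrow> 'a set \<Rightarrow> bool" where
  "C1_on f U \<longleftrightarrow> (\<exists>f' :: 'a \<Rightarrow> 'a \<Rightarrow>\<^sub>L 'b.
     (\<forall>x\<in>U. (f has_derivative blinfun_apply (f' x)) (at x)) \<and> continuous_on U f')"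

text \<open>
  Square root of the sum of the squares of the maximal minors of the matrix \<open>(L(e\<^sub>j))\<^sub>i\<close>. The sum
  is over the sets \<open>S\<close> of chosen columns; the enumeration of \<open>S\<close> only affects the sign of
  the minor.
\<close>

definition minors_norm ::
    "('v \<Rightarrow> real^'k::finite) \<Rightarrow> ('i::finite \<Rightarrow> 'v) \<Rightarrow> real" where
  "minors_norm L e = sqrt (\<Sum>S | card S = CARD('k).
     (det (\<chi> i j. L (e ((SOME \<sigma>. bij_betw \<sigma> (UNIV :: 'k set) S) j)) $ i))\<^sup>2)"

definition jacobian_g :: "('n::finite heis \<Rightarrow> real^'k::finite) \<Rightarrow> 'n heis \<Rightarrow> real" where
  "jacobian_g f x = minors_norm (frechet_derivative f (at x)) (\<lambda>m. heis_frame m x)"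

definition jacobian_H :: "('n::finite heis \<Rightarrow> real^'k::finite) \<Rightarrow> 'n heis \<Rightarrow> real" where
  "jacobian_H f x = minors_norm (frechet_derivative f (at x)) (\<lambda>j. hor_field j x)"


subsection \<open>Tangent and vertical multivectors\<close>

definition tangent_space :: "'a::real_normed_vector set \<Rightarrow> 'a \<Rightarrow> 'a set" where
  "tangent_space M x = {v. \<exists>\<gamma> \<epsilon>. \<epsilon> > 0 \<and> C1_on \<gamma> {-\<epsilon><..<\<epsilon>} \<and> \<gamma> ` {-\<epsilon><..<\<epsilon>} \<subseteq> M \<and>
     \<gamma> 0 = x \<and> (\<gamma> has_vector_derivative v) (at 0)}"

definition orthonormal_basis ::
    "('v::real_vector \<Rightarrow> 'v \<Rightarrow> real) \<Rightarrow> ('p \<Rightarrow> 'v) \<Rightarrow> 'v set \<Rightarrow> bool" where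
  "orthonormal_basis g t T \<longleftrightarrow>
     (\<forall>i j. g (t i) (t j) = (if i = j then 1 else 0)) \<and> span (range t) = T"

definition tangent_pvector :: "'n::finite heis set \<Rightarrow> 'n heis \<Rightarrow> ('p, 'n heis) pvector \<Rightarrow> bool" where
  "tangent_pvector M x \<tau> \<longleftrightarrow>
     (\<exists>t. orthonormal_basis (heis_metric x) t (tangent_space M x) \<and> \<tau> = wedge t)"

text \<open>
  Since the index type \<open>'p\<close> carries no order, \<open>Z\<close> is allowed at any one position; moving it to
  the last one only changes the sign of the generator.
\<close>

definition vertical_pvectors :: "'n::finite heis \<Rightarrow> ('p, 'n heis) pvector set" where
  "vertical_pvectors x = span {wedge (\<lambda>i. if i = l then Z_field x else hor_field (s i) x) | l s. True}"

definition proj_vertical :: "'n::finite heis \<Rightarrow> ('p::finite, 'n heis) pvector \<Rightarrow> ('p, 'n heis) pvector" where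
  "proj_vertical x = pproj (heis_metric x) (vertical_pvectors x)"

end

theory Submission
  imports Defs
begin

text \<open>
  Let \<open>L\<close> be the differential of \<open>f\<close> at \<open>x\<close>, let \<open>T = ker L\<close>, and let \<open>Z\<^sub>T\<close> be the orthogonal projection
  of the unit vertical vector \<open>Z\<close> to \<open>T\<close>. Both sides of the identity are equal to \<open>|Z\<^sub>T|\<close>, the square
  root of \<open>\<Sum>\<^sub>i g(t\<^sub>i, Z)\<^sup>2\<close> for any orthonormal basis \<open>t\<close> of \<open>T\<close>.

  For the left-hand side, \<open>T\<close> is the tangent space of the level set by the inverse function theorem
  (\<open>tangent_space_level_set_subset\<close>, \<open>kernel_subset_tangent_space_level_set\<close>). The horizontal part
  of \<open>\<tau> = t\<^sub>1 \<and> \<dots> \<and> t\<^sub>p\<close> is the wedge product of the horizontal parts of the \<open>t\<^sub>i\<close>, whose Gram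
  determinant is \<open>1 - |Z\<^sub>T|\<^sup>2\<close>; as \<open>|\<tau>| = 1\<close>, the vertical part has norm \<open>|Z\<^sub>T|\<close>
  (\<open>pnorm_pproj_vertical\<close>).

  For the right-hand side, the Cauchy-Binet formula expresses both Jacobians by Gram determinants,
  \<open>J\<^sub>g\<^sup>2 = det (L L\<^sup>*)\<close> and \<open>J\<^sub>H\<^sup>2 = det (L L\<^sup>* - u u\<^sup>T)\<close> with \<open>u = L Z\<close>. The squared ratio is
  \<open>1 - u\<^sup>T (L L\<^sup>*)\<^sup>-\<^sup>1 u\<close>, and the subtracted term is the squared length of the component of \<open>Z\<close>
  orthogonal to \<open>T\<close> (\<open>minors_norm_ratio\<close>).

  Apart from the tangent space, everything takes place in one inner product space with an
  orthonormal frame. The common algebraic tool is the expansion of alternating forms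
  (\<open>alternating_add_multiples\<close>, \<open>alternating_expand\<close>), from which the splitting of \<open>\<tau>\<close>, the Cauchy-Binet
  formula, the determinants above and the definiteness of the scalar product of multivectors all
  follow.
\<close>

section \<open>Expansion of alternating forms\<close>

text \<open>
  Expanding \<open>0 = \<omega>(\<dots>, a + b, \<dots>, a + b, \<dots>)\<close> in both slots leaves only the two mixed terms.
\<close>

lemma alternating_swap:
  assumes "alternating \<omega>" "i \<noteq> j"
  shows "\<omega> (v \<circ> Transposition.transpose i j) = - \<omega> v"
proof -
  define F where "F a b = \<omega> (v(i := a, j := b))" for a b
  have "linear (F a)" for a
    using assms(1) by (simp add: F_def[abs_def] alternating_def)
  then have 1: "F a (b + c) = F a b + F a c" for a b c
    by (rule linear_add)
  have "linear (\<lambda>a. F a b)" for b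
    using assms by (simp add: F_def fun_upd_twist[OF \<open>i \<noteq> j\<close>] alternating_def)
  then have 2: "F (b + c) a = F b a + F c a" for a b c
    by (rule linear_add)
  have 3: "F a a = 0" for a
    using assms by (simp add: F_def alternating_def)
  have "F (v j) (v i) = - F (v i) (v j)"
    using 3[of "v i + v j"] unfolding 1 2 by (simp add: 3)
  moreover have "v(i := v j, j := v i) = v \<circ> Transposition.transpose i j"
    by (auto simp: fun_eq_iff Transposition.transpose_def)
  ultimately show ?thesis
    by (simp add: F_def)
qed

lemma alternating_permute:
  fixes \<omega> :: "('p::finite \<Rightarrow> 'v::real_vector) \<Rightarrow> real"
  assumes "alternating \<omega>" "\<pi> permutes UNIV"
  shows "\<omega> (v \<circ> \<pi>) = of_int (sign \<pi>) * \<omega> v"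
proof -
  have "\<forall>v. \<omega> (v \<circ> \<pi>) = of_int (sign \<pi>) * \<omega> v"
    using assms(2) finite[of UNIV]
  proof (induction rule: permutes_induct)
    case (swap a b p)
    have *: "sign (Transposition.transpose a b \<circ> p) = - sign p"
      using swap by (simp add: sign_compose sign_swap_id permutation_swap_id permutes_imp_permutation[OF finite])
    show ?case
      unfolding comp_assoc[symmetric] spec[OF swap.IH] alternating_swap[OF assms(1) \<open>a \<noteq> b\<close>] *
      by simp
  qed simp
  then show ?thesis ..
qed

text \<open>
  Two slots filled with the same \<open>w\<close> give \<open>0\<close>, so only the terms of degree at most one in \<open>c\<close>
  survive the multilinear expansion. This one identity splits a tangent multivector into its
  horizontal and vertical parts and evaluates the determinant of a rank one perturbation of the
  identity.
\<close>

lemma alternating_add_multiples: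
  fixes \<omega> :: "('p::finite \<Rightarrow> 'v::real_vector) \<Rightarrow> real"
  assumes "alternating \<omega>"
  shows "\<omega> (\<lambda>i. a i + c i *\<^sub>R w) = \<omega> a + (\<Sum>l\<in>UNIV. c l * \<omega> (a(l := w)))"
proof -
  \<comment> \<open>Perturb the slots one at a time: \<open>A\<close> is the set of slots already perturbed.\<close>
  define b where "b A i = (if i \<in> A then a i + c i *\<^sub>R w else a i)" for A i
  have lin: "linear (\<lambda>u. \<omega> (v(i := u)))" for v i
    using assms by (simp add: alternating_def)
  have upd: "b (insert l A) = (b A)(l := a l + c l *\<^sub>R w)" "(b A)(l := a l) = b A" if "l \<notin> A" for l A
    using that by (auto simp: b_def fun_eq_iff)
  have step: "\<omega> (v(l := a l + c l *\<^sub>R w)) = \<omega> (v(l := a l)) + c l * \<omega> (v(l := w))" for v l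
    using linear_add[OF lin] linear_scale[OF lin] by simp
  \<comment> \<open>Once \<open>w\<close> sits in slot \<open>l\<close>, perturbing the other slots by multiples of \<open>w\<close> changes nothing.\<close>
  have one: "\<omega> ((b A)(l := w)) = \<omega> (a(l := w))" if "finite A" "l \<notin> A" for A l
    using that
  proof (induction A)
    case empty
    then show ?case by (simp add: b_def[abs_def])
  next
    case (insert m A)
    then have ml: "m \<noteq> l" by auto
    have "\<omega> ((b (insert m A))(l := w)) = \<omega> ((b A)(l := w, m := a m + c m *\<^sub>R w))"
      using insert ml by (simp add: upd fun_upd_twist)
    also have "\<dots> = \<omega> ((b A)(l := w, m := a m)) + c m * \<omega> ((b A)(l := w, m := w))"
      by (rule step)
    also have "\<omega> ((b A)(l := w, m := w)) = 0"
      using assms ml unfolding alternating_def by (metis fun_upd_apply)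
    also have "(b A)(l := w, m := a m) = (b A)(l := w)"
      using insert ml by (simp add: fun_upd_twist[OF ml[symmetric]] upd)
    finally show ?case
      using insert by simp
  qed
  have "\<omega> (b A) = \<omega> a + (\<Sum>l\<in>A. c l * \<omega> (a(l := w)))" if "finite A" for A
    using that
  proof (induction A)
    case empty
    then show ?case by (simp add: b_def[abs_def])
  next
    case (insert l A)
    have "\<omega> (b (insert l A)) = \<omega> (b A) + c l * \<omega> (a(l := w))"
      unfolding upd(1)[OF insert(2)] step upd(2)[OF insert(2)] one[OF insert(1,2)] ..
    then show ?case
      unfolding insert.IH sum.insert[OF insert(1,2)] by (simp only: add_ac)
  qed
  from this[of UNIV] show ?thesis
    by (simp add: b_def[abs_def])
qed

lemma alternating_sum_expand:
  fixes \<omega> :: "('p::finite \<Rightarrow> 'v::real_vector) \<Rightarrow> real" and e :: "'i::finite \<Rightarrow> 'v"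
  assumes "alternating \<omega>"
  shows "\<omega> (\<lambda>i. \<Sum>m\<in>UNIV. c i m *\<^sub>R e m) = (\<Sum>s\<in>UNIV. (\<Prod>i\<in>UNIV. c i (s i)) * \<omega> (e \<circ> s))"
proof -
  have lin: "linear (\<lambda>u. \<omega> (v(i := u)))" for v i
    using assms by (simp add: alternating_def)
  \<comment> \<open>Expand the slots in \<open>A\<close> and leave arbitrary vectors \<open>v\<close> in the others, so that the
    induction hypothesis applies with \<open>v\<close> changed at the new slot.\<close>
  have "\<omega> (\<lambda>i. if i \<in> A then \<Sum>m\<in>UNIV. c i m *\<^sub>R e m else v i) =
      (\<Sum>s\<in>A \<rightarrow>\<^sub>E UNIV. (\<Prod>i\<in>A. c i (s i)) * \<omega> (\<lambda>i. if i \<in> A then e (s i) else v i))"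
    if "finite A" for A v
    using that
  proof (induction A arbitrary: v)
    case empty
    then show ?case by simp
  next
    case (insert l A)
    let ?x = "\<Sum>m\<in>UNIV. c l m *\<^sub>R e m"
    let ?r = "\<lambda>s v i. if i \<in> A then e (s i) else v i"
    have ins: "(\<lambda>i. if i \<in> insert l A then h i else v i) =
        (\<lambda>i. if i \<in> A then h i else (v(l := h l)) i)" for h :: "'p \<Rightarrow> 'v"
      using insert(1,2) by (auto simp: fun_eq_iff)
    have upd: "(\<lambda>i. if i \<in> A then h i else (v(l := u)) i) = (\<lambda>i. if i \<in> A then h i else v i)(l := u)"
      for u and h :: "'p \<Rightarrow> 'v"
      using insert(1,2) by (auto simp: fun_eq_iff)
    have "\<omega> (\<lambda>i. if i \<in> insert l A then \<Sum>m\<in>UNIV. c i m *\<^sub>R e m else v i) =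
        (\<Sum>s\<in>A \<rightarrow>\<^sub>E UNIV. (\<Prod>i\<in>A. c i (s i)) * \<omega> (?r s (v(l := ?x))))"
      unfolding ins by (rule insert.IH)
    also have "\<dots> = (\<Sum>s\<in>A \<rightarrow>\<^sub>E UNIV. \<Sum>m\<in>UNIV. (\<Prod>i\<in>A. c i (s i)) * (c l m * \<omega> (?r s (v(l := e m)))))"
      unfolding upd by (simp add: linear_sum[OF lin] linear_scale[OF lin] sum_distrib_left)
    also have "\<dots> = (\<Sum>(m, s)\<in>UNIV \<times> (A \<rightarrow>\<^sub>E UNIV). (\<Prod>i\<in>A. c i (s i)) * (c l m * \<omega> (?r s (v(l := e m)))))"
      by (subst sum.swap) (simp only: sum.cartesian_product)
    also have "\<dots> = (\<Sum>(m, s)\<in>UNIV \<times> (A \<rightarrow>\<^sub>E UNIV). (\<Prod>i\<in>insert l A. c i ((s(l := m)) i)) *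
        \<omega> (\<lambda>i. if i \<in> insert l A then e ((s(l := m)) i) else v i))"
    proof -
      have "(\<Prod>i\<in>A. c i (s i)) * (c l m * \<omega> (?r s (v(l := e m)))) =
          (\<Prod>i\<in>insert l A. c i ((s(l := m)) i)) *
          \<omega> (\<lambda>i. if i \<in> insert l A then e ((s(l := m)) i) else v i)" for m s
      proof -
        have "(\<Prod>i\<in>A. c i ((s(l := m)) i)) = (\<Prod>i\<in>A. c i (s i))"
          using insert(1,2) by (intro prod.cong) auto
        moreover have "(\<lambda>i. if i \<in> insert l A then e ((s(l := m)) i) else v i) = ?r s (v(l := e m))"
          using insert(1,2) by (auto simp: fun_eq_iff)
        ultimately show ?thesis
          by (simp only: prod.insert[OF insert(1,2)] fun_upd_same mult_ac)
      qed
      then show ?thesis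
        by (intro sum.cong[OF refl]) (simp only: split_beta)
    qed
    also have "\<dots> = (\<Sum>s\<in>insert l A \<rightarrow>\<^sub>E UNIV. (\<Prod>i\<in>insert l A. c i (s i)) *
        \<omega> (\<lambda>i. if i \<in> insert l A then e (s i) else v i))"
      unfolding PiE_insert_eq
      by (subst sum.reindex) (use inj_combinator[OF insert(2), of "\<lambda>_. UNIV"] in \<open>auto simp: case_prod_unfold\<close>)
    finally show ?case .
  qed
  from this[of UNIV] show ?thesis
    by (simp add: PiE_UNIV_domain comp_def)
qed

lemma bij_betw_SOME_enumeration:
  assumes "card S = CARD('p)"
  shows "bij_betw (SOME \<sigma>. bij_betw \<sigma> (UNIV :: 'p::finite set) S) UNIV S"
proof -
  have "finite S"
    using assms by (metis card_eq_0_iff finite_UNIV_card_ge_0 finite less_irrefl)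
  then show ?thesis
    by (metis assms finite finite_same_card_bij someI_ex)
qed

text \<open>
  In the expansion over all maps \<open>s\<close> from slots to frame indices, the non-injective ones contribute
  \<open>0\<close>. The injective ones with range \<open>S\<close> are the permutations of any one enumeration of \<open>S\<close>, and by
  antisymmetry their coefficients add up to the Leibniz formula of a minor. The enumeration chosen
  by \<open>SOME\<close> is the one in the definition of \<open>minors_norm\<close>, so that the two can be matched.
\<close>

lemma alternating_expand:
  fixes \<omega> :: "('p::finite \<Rightarrow> 'v::real_vector) \<Rightarrow> real" and e :: "'i::finite \<Rightarrow> 'v"
  assumes "alternating \<omega>"
  shows "\<omega> (\<lambda>i. \<Sum>m\<in>UNIV. c i m *\<^sub>R e m) = (\<Sum>S | card S = CARD('p).
    det (\<chi> i j. c i ((SOME \<sigma>. bij_betw \<sigma> (UNIV :: 'p set) S) j)) *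
    \<omega> (e \<circ> (SOME \<sigma>. bij_betw \<sigma> (UNIV :: 'p set) S)))"
proof -
  let ?h = "\<lambda>s. (\<Prod>i\<in>UNIV. c i (s i)) * \<omega> (e \<circ> s)"
  let ?\<sigma> = "\<lambda>S. SOME \<sigma>. bij_betw \<sigma> (UNIV :: 'p set) S"
  have "\<omega> (\<lambda>i. \<Sum>m\<in>UNIV. c i m *\<^sub>R e m) = (\<Sum>s\<in>UNIV. ?h s)"
    by (rule alternating_sum_expand[OF assms])
  also have "\<dots> = (\<Sum>s | inj s. ?h s)"
  proof (rule sum.mono_neutral_right)
    show "\<forall>s\<in>UNIV - {s. inj s}. ?h s = 0"
    proof
      fix s assume "s \<in> UNIV - {s :: 'p \<Rightarrow> 'i. inj s}"
      then obtain i j where "i \<noteq> j" "s i = s j"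
        by (auto simp: inj_def)
      then have "\<omega> (e \<circ> s) = 0"
        using assms unfolding alternating_def by (metis comp_apply)
      then show "?h s = 0" by simp
    qed
  qed auto
  also have "\<dots> = (\<Sum>S | card S = CARD('p). \<Sum>s | s \<in> {s. inj s} \<and> range s = S. ?h s)"
    by (rule sum.group[symmetric]) (auto simp: card_image)
  also have "\<dots> = (\<Sum>S | card S = CARD('p). det (\<chi> i j. c i (?\<sigma> S j)) * \<omega> (e \<circ> ?\<sigma> S))"
  proof (rule sum.cong[OF refl])
    fix S :: "'i set" assume "S \<in> {S. card S = CARD('p)}"
    then have \<sigma>: "bij_betw (?\<sigma> S) UNIV S"
      by (intro bij_betw_SOME_enumeration) simp
    have bij: "bij_betw (\<lambda>\<pi>. ?\<sigma> S \<circ> \<pi>) {\<pi>. \<pi> permutes UNIV} {s. s \<in> {s. inj s} \<and> range s = S}"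
    proof (rule bij_betw_byWitness[where f' = "\<lambda>s. inv_into UNIV (?\<sigma> S) \<circ> s"])
      have inj: "inj (?\<sigma> S)" and ran: "range (?\<sigma> S) = S"
        using \<sigma> by (auto simp: bij_betw_def)
      show "\<forall>\<pi>\<in>{\<pi>. \<pi> permutes UNIV}. inv_into UNIV (?\<sigma> S) \<circ> (?\<sigma> S \<circ> \<pi>) = \<pi>"
        using inj by (simp add: fun_eq_iff)
      show "\<forall>s\<in>{s. s \<in> {s. inj s} \<and> range s = S}. ?\<sigma> S \<circ> (inv_into UNIV (?\<sigma> S) \<circ> s) = s"
        using ran by (auto simp: fun_eq_iff f_inv_into_f)
      show "(\<lambda>\<pi>. ?\<sigma> S \<circ> \<pi>) ` {\<pi>. \<pi> permutes UNIV} \<subseteq> {s. s \<in> {s. inj s} \<and> range s = S}"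
      proof clarify
        fix \<pi> :: "'p \<Rightarrow> 'p" assume \<pi>: "\<pi> permutes UNIV"
        have "inj (?\<sigma> S \<circ> \<pi>)"
          using inj permutes_inj[OF \<pi>] by (rule inj_compose)
        moreover have "range (?\<sigma> S \<circ> \<pi>) = S"
          using ran permutes_surj[OF \<pi>] by (simp only: image_comp[symmetric])
        ultimately show "?\<sigma> S \<circ> \<pi> \<in> {s. inj s} \<and> range (?\<sigma> S \<circ> \<pi>) = S"
          by simp
      qed
      show "(\<lambda>s. inv_into UNIV (?\<sigma> S) \<circ> s) ` {s. s \<in> {s. inj s} \<and> range s = S} \<subseteq> {\<pi>. \<pi> permutes UNIV}"
      proof clarify
        fix s :: "'p \<Rightarrow> 'i" assume s: "inj s" "S = range s"
        have "bij_betw s UNIV S"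
          using s by (simp add: bij_betw_def)
        from bij_betw_trans[OF this bij_betw_inv_into[OF \<sigma>]]
        show "inv_into UNIV (?\<sigma> (range s)) \<circ> s permutes UNIV"
          using s by (intro bij_imp_permutes) auto
      qed
    qed
    have "(\<Sum>s | s \<in> {s. inj s} \<and> range s = S. ?h s) = (\<Sum>\<pi> | \<pi> permutes UNIV. ?h (?\<sigma> S \<circ> \<pi>))"
      by (rule sum.reindex_bij_betw[OF bij, symmetric])
    also have "\<dots> = det (\<chi> i j. c i (?\<sigma> S j)) * \<omega> (e \<circ> ?\<sigma> S)"
      unfolding det_def sum_distrib_right
      by (intro sum.cong[OF refl]) (simp add: comp_assoc[symmetric] alternating_permute[OF assms] mult_ac)
    finally show "(\<Sum>s | s \<in> {s. inj s} \<and> range s = S. ?h s) = \<dots>" .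
  qed
  finally show ?thesis .
qed

section \<open>The Cauchy-Binet formula and rank one perturbations\<close>

lemma alternating_det: "alternating (\<lambda>v :: 'k::finite \<Rightarrow> real^'k. det (vec_lambda v))"
proof -
  have "alternating (\<lambda>v :: 'k \<Rightarrow> real^'k. det (\<chi> i j. inner (v i) (axis j 1)))"
    by (rule alternating_det_rows) (simp add: linear_iff inner_simps)
  then show ?thesis
    by (simp add: inner_axis)
qed

text \<open>
  The determinant of the rows \<open>\<Sum>\<^sub>m L(e\<^sub>m)\<^sub>i L(e\<^sub>m)\<close> is an alternating form evaluated at combinations
  of the columns \<open>L(e\<^sub>m)\<close>; in its expansion each coefficient is a minor and each value is
  the same minor transposed, whence the squares.
\<close>

lemma Cauchy_Binet:
  fixes L :: "'v \<Rightarrow> real^'k::finite" and e :: "'i::finite \<Rightarrow> 'v"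
  shows "minors_norm L e = sqrt (det (\<chi> i j. \<Sum>m\<in>UNIV. L (e m) $ i * L (e m) $ j))"
proof -
  let ?\<sigma> = "\<lambda>S. SOME \<sigma>. bij_betw \<sigma> (UNIV :: 'k set) S"
  have "(\<chi> i j. \<Sum>m\<in>UNIV. L (e m) $ i * L (e m) $ j) = (\<chi> i. \<Sum>m\<in>UNIV. L (e m) $ i *\<^sub>R L (e m))"
    by (simp add: vec_eq_iff)
  also have "det \<dots> = (\<Sum>S | card S = CARD('k).
      det (\<chi> i j. L (e (?\<sigma> S j)) $ i) * det (vec_lambda ((\<lambda>m. L (e m)) \<circ> ?\<sigma> S)))"
    by (rule alternating_expand[OF alternating_det])
  finally have det: "det (\<chi> i j. \<Sum>m\<in>UNIV. L (e m) $ i * L (e m) $ j) = \<dots>" .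
  have transpose: "vec_lambda ((\<lambda>m. L (e m)) \<circ> s) = transpose (\<chi> i j. L (e (s j)) $ i)" for s
    by (simp add: vec_eq_iff transpose_def)
  show ?thesis
    unfolding minors_norm_def det transpose det_transpose power2_eq_square ..
qed

text \<open>
  The rows are the unit vectors, perturbed by multiples of \<open>v\<close>; with row \<open>l\<close> replaced by \<open>v\<close>, the
  identity matrix has determinant \<open>v $ l\<close> by Cramer's rule.
\<close>

lemma det_mat1_plus_rank_one:
  fixes u v :: "real^'n"
  shows "det (\<chi> i j. (if i = j then 1 else 0) + u $ i * v $ j) = 1 + (\<Sum>i\<in>UNIV. u $ i * v $ i)"
proof -
  let ?r = "\<lambda>i :: 'n. axis i (1 :: real)"
  have "det (vec_lambda (?r(l := v))) = v $ l" for l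
  proof -
    have v: "(\<Sum>i\<in>UNIV. v $ i *s row i (mat 1 :: real^'n^'n)) = v"
      by (simp add: vec_eq_iff row_def mat_def if_distrib cong: if_cong)
    have "vec_lambda (?r(l := v)) =
        (\<chi> i. if i = l then \<Sum>i\<in>UNIV. v $ i *s row i (mat 1 :: real^'n^'n) else row i (mat 1))"
      unfolding v by (auto simp: vec_eq_iff row_def mat_def axis_def)
    also have "det \<dots> = v $ l * det (mat 1 :: real^'n^'n)"
      by (rule cramer_lemma_transpose)
    finally show ?thesis by simp
  qed
  moreover have "vec_lambda ?r = mat 1"
    by (auto simp: vec_eq_iff mat_def axis_def)
  moreover have "(\<chi> i. ?r i + u $ i *\<^sub>R v) = (\<chi> i j. (if i = j then 1 else 0) + u $ i * v $ j)"
    by (auto simp: vec_eq_iff axis_def)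
  ultimately show ?thesis
    using alternating_add_multiples[OF alternating_det, of ?r "\<lambda>i. u $ i" v] by simp
qed

section \<open>Multivectors over an orthonormal frame\<close>

lemma Rep_pvector_sum: "Rep_pvector (\<Sum>a\<in>A. \<xi> a) \<omega> = (\<Sum>a\<in>A. Rep_pvector (\<xi> a) \<omega>)"
  by (induction A rule: infinite_finite_induct) (simp_all add: Rep_pvector_0 Rep_pvector_add)

lemma pvector_eqI: "(\<And>\<omega>. Rep_pvector \<xi> \<omega> = Rep_pvector \<eta> \<omega>) \<Longrightarrow> \<xi> = \<eta>"
  by (simp add: Rep_pvector_inject[symmetric] fun_eq_iff)

lemma alternating_Rep: "alternating (Rep_alt_form \<omega>)"
  using Rep_alt_form[of \<omega>] by simp

lemma wedge_add_multiples:
  fixes a :: "'p::finite \<Rightarrow> 'v::real_vector"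
  shows "wedge (\<lambda>i. a i + c i *\<^sub>R w) = wedge a + (\<Sum>l\<in>UNIV. c l *\<^sub>R wedge (a(l := w)))"
  by (rule pvector_eqI)
     (simp only: Rep_pvector_wedge Rep_pvector_add Rep_pvector_sum Rep_pvector_scale
        alternating_add_multiples[OF alternating_Rep])

lemma wedge_sum_expand:
  fixes e :: "'i::finite \<Rightarrow> 'v::real_vector"
  shows "wedge (\<lambda>i :: 'p::finite. \<Sum>m\<in>UNIV. c i m *\<^sub>R e m) =
    (\<Sum>s\<in>UNIV. (\<Prod>i\<in>UNIV. c i (s i)) *\<^sub>R wedge (e \<circ> s))"
  by (rule pvector_eqI)
     (simp only: Rep_pvector_wedge Rep_pvector_sum Rep_pvector_scale
        alternating_sum_expand[OF alternating_Rep])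

text \<open>
  The expansion axiom says that the frame spans; together with orthonormality it makes \<open>g\<close> the
  standard inner product in the coordinates of the frame, hence positive definite.
\<close>

locale orthonormal_frame =
  fixes g :: "'v::real_vector \<Rightarrow> 'v \<Rightarrow> real" and e :: "'i::finite \<Rightarrow> 'v"
  assumes bilinear: "bilinear g"
    and sym: "g v w = g w v"
    and orthonormal: "g (e i) (e j) = (if i = j then 1 else 0)"
    and expansion: "(\<Sum>m\<in>UNIV. g v (e m) *\<^sub>R e m) = v"
begin

lemma linear_right: "linear (g v)" and linear_left: "linear (\<lambda>v. g v w)"
  using bilinear by (simp_all add: bilinear_def)

lemmas g_simps =
  linear_add[OF linear_right] linear_scale[OF linear_right] linear_diff[OF linear_right]
  linear_sum[OF linear_right] linear_0[OF linear_right]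
  linear_add[OF linear_left] linear_scale[OF linear_left] linear_diff[OF linear_left]
  linear_sum[OF linear_left] linear_0[OF linear_left]

lemma parseval: "g v w = (\<Sum>m\<in>UNIV. g v (e m) * g w (e m))"
proof -
  have "g v w = g v (\<Sum>m\<in>UNIV. g w (e m) *\<^sub>R e m)"
    by (simp add: expansion)
  then show ?thesis
    by (simp add: g_simps mult.commute)
qed

lemma parseval_span:
  fixes t :: "'p::finite \<Rightarrow> 'v"
  assumes t: "\<And>i j. g (t i) (t j) = (if i = j then 1 else 0)" and w: "w \<in> span (range t)"
  shows "g u w = (\<Sum>i\<in>UNIV. g (t i) u * g (t i) w)"
  using w
proof (induction rule: span_induct)
  case base
  have "linear (\<lambda>w. g u w - (\<Sum>i\<in>UNIV. g (t i) u * g (t i) w))"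
    by (rule linearI) (simp_all add: g_simps algebra_simps sum.distrib sum_distrib_left)
  from linear_subspace_kernel[OF this] show ?case
    by simp
next
  case (step x)
  then show ?case
    by (auto simp: t sym[of u] if_distrib cong: if_cong)
qed

lemma definite: "g v v = 0 \<Longrightarrow> v = 0"
proof -
  assume "g v v = 0"
  then have "g v (e m) = 0" for m
    by (simp add: parseval[of v v] sum_nonneg_eq_0_iff)
  then show ?thesis
    using expansion[of v] by simp
qed

text \<open>
  A multivector is a functional on alternating forms, and every alternating form \<open>\<omega>\<close> is the
  combination \<open>\<Sum>\<^sub>S \<omega>(e\<^sub>S) \<langle>e\<^sub>S, \<cdot>\<rangle>\<close> of the forms dual to the frame multivectors \<open>e\<^sub>S\<close>. A multivector
  is therefore determined by its coordinates \<open>\<langle>e\<^sub>S, \<xi>\<rangle>\<close>.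
\<close>

lemma Rep_pvector_expand:
  fixes \<xi> :: "('p::finite, 'v) pvector"
  shows "Rep_pvector \<xi> \<omega> = (\<Sum>S | card S = CARD('p).
    Rep_pvector \<xi> (gram_form g (e \<circ> (SOME \<sigma>. bij_betw \<sigma> (UNIV :: 'p set) S))) *
    Rep_alt_form \<omega> (e \<circ> (SOME \<sigma>. bij_betw \<sigma> (UNIV :: 'p set) S)))"
proof -
  let ?e = "\<lambda>S. e \<circ> (SOME \<sigma>. bij_betw \<sigma> (UNIV :: 'p set) S)"
  obtain A c where A: "finite A" "Rep_pvector \<xi> = (\<lambda>\<omega>. \<Sum>v\<in>A. c v * Rep_alt_form \<omega> v)"
    by (rule Rep_pvectorE)
  have expand: "Rep_alt_form \<omega> v =
      (\<Sum>S | card S = CARD('p). Rep_alt_form (gram_form g (?e S)) v * Rep_alt_form \<omega> (?e S))" for v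
  proof -
    have "det (\<chi> i j. g (v i) (e (s j))) = Rep_alt_form (gram_form g (e \<circ> s)) v" for s
      using det_transpose[of "\<chi> i j. g (v i) (e (s j))"]
      by (simp add: Rep_gram_form[OF bilinear] transpose_def sym[of "e _"])
    then show ?thesis
      using alternating_expand[OF alternating_Rep[of \<omega>], of "\<lambda>i m. g (v i) (e m)" e]
      by (simp add: expansion)
  qed
  have "Rep_pvector \<xi> \<omega> = (\<Sum>v\<in>A. \<Sum>S | card S = CARD('p).
      c v * (Rep_alt_form (gram_form g (?e S)) v * Rep_alt_form \<omega> (?e S)))"
    unfolding A sum_distrib_left[symmetric] expand[symmetric] ..
  also have "\<dots> = (\<Sum>S | card S = CARD('p). Rep_pvector \<xi> (gram_form g (?e S)) * Rep_alt_form \<omega> (?e S))"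
    unfolding A by (subst sum.swap) (simp only: sum_distrib_right mult.assoc)
  finally show ?thesis .
qed

text \<open>
  In these coordinates the scalar product is the sum of the products of the coordinates.
  Definiteness is what makes the orthogonal projection unique, so that the description by
  \<open>THE\<close> in \<open>pproj\<close> denotes.
\<close>

lemma pinner_definite:
  fixes \<xi> :: "('p::finite, 'v) pvector"
  assumes "pinner g \<xi> \<xi> = 0"
  shows "\<xi> = 0"
proof -
  let ?c = "\<lambda>S. Rep_pvector \<xi> (gram_form g (e \<circ> (SOME \<sigma>. bij_betw \<sigma> (UNIV :: 'p set) S)))"
  have "pinner g \<xi> \<xi> = (\<Sum>S | card S = CARD('p). ?c S * ?c S)"
    unfolding pinner_def Rep_pvector_expand[of \<xi> "Abs_alt_form _"] Rep_flat[OF bilinear] ..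
  with assms have "?c S = 0" if "card S = CARD('p)" for S
    using that by (simp add: sum_nonneg_eq_0_iff)
  then have "Rep_pvector \<xi> \<omega> = Rep_pvector 0 \<omega>" for \<omega>
    by (subst Rep_pvector_expand) (simp add: Rep_pvector_0)
  then show ?thesis
    by (rule pvector_eqI)
qed

lemma pproj_eqI:
  fixes \<xi> :: "('p::finite, 'v) pvector"
  assumes "subspace W" "\<eta> \<in> W" "\<And>\<zeta>. \<zeta> \<in> W \<Longrightarrow> pinner g (\<xi> - \<eta>) \<zeta> = 0"
  shows "pproj g W \<xi> = \<eta>"
  unfolding pproj_def
proof (rule the_equality)
  fix \<eta>' assume \<eta>': "\<eta>' \<in> W \<and> (\<forall>\<zeta>\<in>W. pinner g (\<xi> - \<eta>') \<zeta> = 0)"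
  have "linear (\<lambda>\<xi>. pinner g \<xi> (\<eta>' - \<eta>))"
    using bilinear_pinner[OF bilinear, where 'p = 'p] by (simp add: bilinear_def)
  from linear_diff[OF this, of "\<xi> - \<eta>" "\<xi> - \<eta>'"]
  have "pinner g (\<eta>' - \<eta>) (\<eta>' - \<eta>) = 0"
    using assms \<eta>' by (simp add: subspace_diff)
  then have "\<eta>' - \<eta> = 0"
    by (rule pinner_definite)
  then show "\<eta>' = \<eta>"
    by simp
qed (use assms in auto)

text \<open>
  The frame identifies the space isometrically with \<open>real^'i\<close>, where the kernel of a surjection
  \<open>M\<close> is the orthogonal complement of the range of its adjoint. As the adjoint is injective,
  that range has dimension \<open>CARD('k)\<close>, and the kernel has the dimension \<open>CARD('p)\<close> that is left.
\<close>

lemma ex_orthonormal_basis_kernel: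
  fixes L :: "'v \<Rightarrow> real^'k"
  assumes "linear L" "surj L" "CARD('p::finite) + CARD('k) = CARD('i)"
  shows "\<exists>t :: 'p \<Rightarrow> 'v. orthonormal_basis g t {v. L v = 0}"
proof -
  define \<psi> where "\<psi> c = (\<Sum>m\<in>UNIV. c $ m *\<^sub>R e m)" for c :: "real^'i"
  have lin: "linear \<psi>"
    by (rule linearI) (simp_all add: \<psi>_def scaleR_add_left sum.distrib scaleR_sum_right)
  have iso: "g (\<psi> b) (\<psi> c) = b \<bullet> c" for b c
  proof -
    have "g (\<psi> b) (e m) = b $ m" for b m
      by (simp add: \<psi>_def g_simps orthonormal if_distrib cong: if_cong)
    then show ?thesis
      by (simp add: parseval[of "\<psi> b"] inner_vec_def)
  qed
  have surj: "surj \<psi>"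
    by (rule surjI[of _ "\<lambda>v. \<chi> m. g v (e m)"]) (simp add: \<psi>_def expansion)
  define M where "M = L \<circ> \<psi>"
  have M: "linear M" "surj M"
    unfolding M_def by (rule linear_compose[OF lin assms(1)], rule comp_surj[OF surj assms(2)])
  have "dim (range (adjoint M)) = CARD('k)"
  proof -
    have "inj (adjoint M)"
      using M by simp
    then show ?thesis
      using dim_image_eq[OF adjoint_linear[OF M(1)], of UNIV]
      by (simp only: span_UNIV dim_UNIV DIM_cart DIM_real mult_1_right)
  qed
  moreover have "dim {y \<in> UNIV. \<forall>x\<in>range (adjoint M). orthogonal x y} + dim (range (adjoint M)) = CARD('i)"
    using dim_subspace_orthogonal_to_vectors[OF
        linear_subspace_image[OF adjoint_linear[OF M(1)] subspace_UNIV] subspace_UNIV subset_UNIV]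
    by (simp only: dim_UNIV DIM_cart DIM_real mult_1_right)
  moreover have "{y \<in> UNIV. \<forall>x\<in>range (adjoint M). orthogonal x y} = {c. M c = 0}"
    using ker_orthogonal_comp_adjoint[OF M(1)]
    by (simp add: orthogonal_comp_def vimage_def)
  ultimately have dim: "dim {c. M c = 0} = CARD('p)"
    using assms by simp
  have "subspace {c. M c = 0}"
    by (rule linear_subspace_kernel[OF M(1)])
  then obtain B where "B \<subseteq> {c. M c = 0}" and B: "pairwise orthogonal B" "\<forall>x\<in>B. norm x = 1"
      "independent B" "card B = dim {c. M c = 0}" "span B = {c. M c = 0}"
    by (rule orthonormal_basis_subspace) blast
  have "card (UNIV :: 'p set) = card B"
    using B(4) dim by simp
  with finite_class.finite_UNIV independent_imp_finite[OF B(3)]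
  have "\<exists>b. bij_betw b (UNIV :: 'p set) B"
    by (rule finite_same_card_bij)
  then obtain b :: "'p \<Rightarrow> real^'i" where b: "bij_betw b UNIV B" ..
  have "b i \<bullet> b j = (if i = j then 1 else 0)" for i j
  proof -
    have "b i \<in> B" "b j \<in> B" "b i = b j \<longleftrightarrow> i = j"
      using b by (auto simp: bij_betw_def inj_def)
    then show ?thesis
      using B by (auto simp: pairwise_def orthogonal_def norm_eq_1)
  qed
  moreover have "span (range (\<psi> \<circ> b)) = {v. L v = 0}"
  proof -
    have "range (\<psi> \<circ> b) = \<psi> ` B"
      using b by (auto simp: bij_betw_def)
    then have "span (range (\<psi> \<circ> b)) = \<psi> ` {c. M c = 0}"
      by (simp only: linear_span_image[OF lin] B)
    also have "\<dots> = {v. L v = 0}"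
    proof (intro equalityI subsetI)
      fix v assume "v \<in> {v. L v = 0}"
      moreover obtain c where "v = \<psi> c"
        using surj by (rule surjE)
      ultimately show "v \<in> \<psi> ` {c. M c = 0}"
        by (simp add: M_def)
    qed (auto simp: M_def)
    finally show ?thesis .
  qed
  ultimately have "orthonormal_basis g (\<psi> \<circ> b) {v. L v = 0}"
    by (simp add: orthonormal_basis_def iso)
  then show ?thesis
    by (intro exI[of _ "\<psi> \<circ> b"])
qed

end

section \<open>Tangent spaces of level sets\<close>

text \<open>
  Solutions of an injective linear equation depend continuously on the operator: the difference
  \<open>d = w s - w t\<close> satisfies \<open>M t d = - (M s - M t) (d + w t)\<close>, and injectivity of \<open>M t\<close> in finite
  dimension gives \<open>norm (M t d) \<ge> B * norm d\<close>, so that the term with \<open>d\<close> on the right is absorbed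
  once \<open>M s\<close> is within \<open>B / 2\<close> of \<open>M t\<close>. This turns the pointwise derivative of a local inverse
  into a continuous one.
\<close>

lemma continuous_on_blinfun_preimage:
  fixes M :: "'c::topological_space \<Rightarrow> 'a::euclidean_space \<Rightarrow>\<^sub>L 'b::euclidean_space"
  assumes M: "continuous_on I M" and inj: "\<And>t. t \<in> I \<Longrightarrow> inj (M t)"
    and w: "\<And>t. t \<in> I \<Longrightarrow> M t (w t) = c"
  shows "continuous_on I w"
  unfolding continuous_on_def
proof
  fix t assume t: "t \<in> I"
  obtain B where B: "B > 0" "\<And>u. B * norm u \<le> norm (M t u)"
    using linear_inj_bounded_below_pos[OF bounded_linear.linear[OF blinfun.bounded_linear_right] inj[OF t]]
    by blast
  have lim: "((\<lambda>s. norm (M s - M t)) \<longlongrightarrow> 0) (at t within I)"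
    using M t by (simp add: continuous_on_def tendsto_norm_zero LIM_zero)
  have "\<forall>\<^sub>F s in at t within I. norm (M s - M t) < B / 2"
    using order_tendstoD(2)[OF lim, of "B / 2"] B by simp
  moreover have "\<forall>\<^sub>F s in at t within I. s \<in> I"
    by (simp add: eventually_at_filter)
  ultimately have "\<forall>\<^sub>F s in at t within I. norm (w s - w t) \<le> 2 / B * norm (w t) * norm (M s - M t)"
  proof eventually_elim
    case (elim s)
    define d where "d = w s - w t"
    have "M t d = - (M s - M t) d - (M s - M t) (w t)"
      using w[OF t] w[OF elim(2)] by (simp add: d_def blinfun.bilinear_simps)
    then have "norm (M t d) \<le> norm ((M s - M t) d) + norm ((M s - M t) (w t))"
      by (metis norm_minus_cancel norm_triangle_ineq4)
    also have "\<dots> \<le> norm (M s - M t) * norm d + norm (M s - M t) * norm (w t)"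
      by (intro add_mono norm_blinfun)
    also have "\<dots> \<le> B / 2 * norm d + norm (M s - M t) * norm (w t)"
      using elim by (intro add_right_mono mult_right_mono) auto
    finally have "B * norm d \<le> 2 * (norm (M s - M t) * norm (w t))"
      using B(2)[of d] by simp
    then show ?case
      using \<open>B > 0\<close> by (simp add: d_def[symmetric] field_simps)
  qed
  then show "(w \<longlongrightarrow> w t) (at t within I)"
    by (rule Lim_null_comparison[THEN LIM_zero_cancel])
       (use tendsto_mult_left[OF lim, of "2 / B * norm (w t)"] in simp)
qed

lemma tangent_space_level_set_subset:
  assumes "C1_on f \<Omega>" "v \<in> tangent_space {y \<in> \<Omega>. f y = 0} x"
  shows "frechet_derivative f (at x) v = 0"
proof -
  obtain \<gamma> \<epsilon> where \<gamma>: "\<epsilon> > 0" "\<gamma> ` {-\<epsilon><..<\<epsilon>} \<subseteq> {y \<in> \<Omega>. f y = 0}" "\<gamma> 0 = x"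
      "(\<gamma> has_vector_derivative v) (at (0::real))"
    using assms(2) by (auto simp: tangent_space_def)
  then have "x \<in> \<Omega>"
    by force
  then have "f differentiable (at x)"
    using assms(1) by (auto simp: C1_on_def differentiable_def)
  then have "(f has_derivative frechet_derivative f (at x)) (at (\<gamma> 0))"
    by (simp add: frechet_derivative_works \<gamma>)
  with \<gamma>(4) have "((f \<circ> \<gamma>) has_vector_derivative frechet_derivative f (at x) v) (at 0)"
    by (auto intro!: vector_derivative_diff_chain_within has_derivative_at_withinI)
  moreover have "((\<lambda>_. 0) has_vector_derivative 0) (at (0::real))"
    by simp
  then have "((f \<circ> \<gamma>) has_vector_derivative 0) (at 0)"
    by (rule has_vector_derivative_transform_within_open[of _ _ _ "{-\<epsilon><..<\<epsilon>}"])
       (use \<gamma>(1,2) in \<open>auto simp: image_subset_iff\<close>)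
  ultimately show ?thesis
    by (rule vector_derivative_unique_at)
qed

text \<open>
  Near \<open>x\<close> one corrects the straight line \<open>x + s v\<close> by a right inverse \<open>R\<close> of the differential: the
  map \<open>\<Phi>(y, s) = (f (x + R y + s v), s)\<close> has the identity as its differential at \<open>0\<close> because \<open>v\<close>
  is in the kernel. Its local inverse \<open>g\<close> yields the curve \<open>x + R y + s v\<close> with \<open>(y, s) = g (0, s)\<close>,
  which stays in the level set and has velocity \<open>v\<close> at \<open>0\<close>.
\<close>

lemma kernel_subset_tangent_space_level_set:
  fixes f :: "'a::euclidean_space \<Rightarrow> 'b::euclidean_space"
  assumes "open \<Omega>" and C1: "C1_on f \<Omega>" and x: "x \<in> \<Omega>" "f x = 0"
    and surj: "surj (frechet_derivative f (at x))"
    and v: "frechet_derivative f (at x) v = 0"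
  shows "v \<in> tangent_space {y \<in> \<Omega>. f y = 0} x"
proof -
  obtain f' :: "'a \<Rightarrow> 'a \<Rightarrow>\<^sub>L 'b" where f': "\<And>y. y \<in> \<Omega> \<Longrightarrow> (f has_derivative f' y) (at y)"
    and cont: "continuous_on \<Omega> f'"
    using C1 unfolding C1_on_def by blast
  have D: "frechet_derivative f (at x) = f' x"
    using frechet_derivative_at[OF f'[OF x(1)]] by simp
  obtain R where R: "linear R" "\<And>y. f' x (R y) = y"
    using linear_surjective_right_inverse[of "f' x"] surj D
    by (metis blinfun.bounded_linear_right bounded_linear.linear comp_apply id_apply)
  define B :: "('b \<times> real) \<Rightarrow>\<^sub>L 'a" where "B = Blinfun (\<lambda>(y, s). R y + s *\<^sub>R v)"
  have B: "B z = R (fst z) + snd z *\<^sub>R v" for z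
  proof -
    have "bounded_linear (\<lambda>z. R (fst z) + snd z *\<^sub>R v)"
      by (intro bounded_linear_add bounded_linear_compose[OF linear_linear[THEN iffD2, OF R(1)]]
            bounded_linear_fst bounded_linear_scaleR_const bounded_linear_snd)
    then show ?thesis
      by (simp add: B_def bounded_linear_Blinfun_apply case_prod_unfold)
  qed
  \<comment> \<open>The differential of \<open>\<Phi>\<close> is put together from fixed operators by composition and addition,
    so that its continuity follows from the continuity of \<open>f'\<close>.\<close>
  define J :: "'b \<Rightarrow>\<^sub>L ('b \<times> real)" where "J = Blinfun (\<lambda>y. (y, 0))"
  have J: "J y = (y, 0)" for y
    unfolding J_def by (subst bounded_linear_Blinfun_apply) (auto intro!: bounded_linear_Pair)
  define K :: "('b \<times> real) \<Rightarrow>\<^sub>L ('b \<times> real)" where "K = Blinfun (\<lambda>z. (0, snd z))"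
  have K: "K z = (0, snd z)" for z
    unfolding K_def by (subst bounded_linear_Blinfun_apply) (auto intro!: bounded_linear_Pair bounded_linear_snd)
  define \<Phi> where "\<Phi> z = (f (x + B z), snd z)" for z
  define \<Phi>' where "\<Phi>' z = (J o\<^sub>L (f' (x + B z) o\<^sub>L B)) + K" for z
  define U where "U = (\<lambda>z. x + B z) -` \<Omega>"
  have \<Phi>': "\<Phi>' z w = (f' (x + B z) (B w), snd w)" for z w
    by (simp add: \<Phi>'_def J K blinfun.add_left)
  have id: "\<Phi>' 0 = id_blinfun"
    using v by (intro blinfun_eqI) (simp add: \<Phi>' B R D blinfun.bilinear_simps linear_0)
  have 1: "open U"
    unfolding U_def using \<open>open \<Omega>\<close> by (intro open_vimage continuous_intros)
  have 2: "(\<Phi> has_derivative \<Phi>' z) (at z)" if "z \<in> U" for z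
  proof -
    have "((\<lambda>z. f (x + B z)) has_derivative (\<lambda>w. f' (x + B z) (B w))) (at z)"
      by (rule has_derivative_compose[of "\<lambda>z. x + B z", OF _ f'])
         (use that in \<open>auto simp: U_def intro!: derivative_eq_intros\<close>)
    then have "(\<Phi> has_derivative (\<lambda>w. (f' (x + B z) (B w), snd w))) (at z)"
      unfolding \<Phi>_def[abs_def] by (intro has_derivative_Pair has_derivative_snd has_derivative_ident)
    then show ?thesis
      by (simp add: \<Phi>'[abs_def])
  qed
  have 3: "continuous_on U \<Phi>'"
    unfolding \<Phi>'_def[abs_def]
    by (intro continuous_intros continuous_on_compose2[OF cont]) (auto simp: U_def)
  have 4: "0 \<in> U"
    using x by (simp add: U_def blinfun.zero_right)
  have 5: "id_blinfun o\<^sub>L \<Phi>' 0 = id_blinfun"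
    by (rule blinfun_eqI) (simp add: id)
  obtain U' V g g' where U': "open U'" "U' \<subseteq> U" "0 \<in> U'" and V: "open V" "\<Phi> 0 \<in> V"
    and hom: "homeomorphism U' V \<Phi> g"
    and "\<forall>y\<in>V. (g has_derivative (g' y)) (at y) \<and> g' y = inv (\<Phi>' (g y)) \<and> bij (\<Phi>' (g y))"
    using inverse_function_theorem[of U \<Phi> \<Phi>', OF 1 2 3 4 5] by metis
  then have g: "(g has_derivative (g' y)) (at y)" and g': "g' y = inv (\<Phi>' (g y))" "bij (\<Phi>' (g y))"
    if "y \<in> V" for y
    using that by blast+
  have \<Phi>0: "\<Phi> 0 = 0"
    unfolding \<Phi>_def blinfun.zero_right using x by (simp add: prod_eq_iff)
  have \<Phi>g: "g y \<in> U'" "\<Phi> (g y) = y" if "y \<in> V" for y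
    using hom that by (auto simp: homeomorphism_def)
  have g0: "g 0 = 0"
    using hom U' \<Phi>0 by (metis homeomorphism_apply1)
  define \<gamma> where "\<gamma> t = x + B (g (0, t))" for t
  define w where "w t = g' (0, t) (0, 1)" for t
  have "open ((\<lambda>t. (0::'b, t)) -` V)"
    by (intro open_vimage V continuous_intros)
  moreover have "0 \<in> (\<lambda>t. (0::'b, t)) -` V"
    using V \<Phi>0 by (simp add: zero_prod_def)
  ultimately obtain \<epsilon> where \<epsilon>: "\<epsilon> > 0" "ball 0 \<epsilon> \<subseteq> (\<lambda>t. (0::'b, t)) -` V"
    by (rule openE)
  have I: "(0, t) \<in> V" if "t \<in> {-\<epsilon><..<\<epsilon>}" for t
    using that \<epsilon>(2) by (auto simp: subset_iff)
  have dg: "((\<lambda>t. g (0, t)) has_derivative (\<lambda>h. g' (0, t) (0, h))) (at t)" if "t \<in> {-\<epsilon><..<\<epsilon>}" for t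
    by (rule has_derivative_compose[of "Pair 0", OF _ g[OF I[OF that]]])
       (auto intro!: derivative_eq_intros)
  have w: "\<Phi>' (g (0, t)) (w t) = (0, 1)" if "t \<in> {-\<epsilon><..<\<epsilon>}" for t
    unfolding w_def g'(1)[OF I[OF that]]
    by (rule surj_f_inv_f) (use g'(2)[OF I[OF that]] in \<open>simp add: bij_def\<close>)
  have deriv: "(\<gamma> has_derivative (\<lambda>h. h *\<^sub>R B (w t))) (at t)" if t: "t \<in> {-\<epsilon><..<\<epsilon>}" for t
  proof -
    have "(\<gamma> has_derivative (\<lambda>h. B (g' (0, t) (0, h)))) (at t)"
      unfolding \<gamma>_def[abs_def]
      by (auto intro!: derivative_eq_intros dg[OF t])
    moreover have "g' (0, t) (0, h) = h *\<^sub>R w t" for h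
    proof -
      have "linear (g' (0, t))"
        using g[OF I[OF t]] by (rule has_derivative_linear)
      from linear_scale[OF this, of h "(0, 1)"] show ?thesis
        by (simp add: w_def)
    qed
    ultimately show ?thesis
      by (simp add: blinfun.scaleR_right)
  qed
  have "continuous_on {-\<epsilon><..<\<epsilon>} (\<lambda>t. g (0, t))"
    using dg by (meson continuous_at_imp_continuous_on has_derivative_continuous)
  then have "continuous_on {-\<epsilon><..<\<epsilon>} (\<lambda>t. \<Phi>' (g (0, t)))"
    by (rule continuous_on_compose2[OF 3]) (use \<Phi>g I U' in auto)
  then have "continuous_on {-\<epsilon><..<\<epsilon>} w"
    by (rule continuous_on_blinfun_preimage) (use w g'(2) I in \<open>auto simp: bij_def\<close>)
  then have "C1_on \<gamma> {-\<epsilon><..<\<epsilon>}"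
    unfolding C1_on_def
    by (intro exI[of _ "\<lambda>t. blinfun_scaleR_left (B (w t))"]) (auto intro!: continuous_intros deriv)
  moreover have "w 0 = (0, 1)"
    using w[of 0] \<epsilon> by (simp add: g0[unfolded zero_prod_def] id[unfolded zero_prod_def])
  then have "(\<gamma> has_vector_derivative v) (at 0)"
    using deriv[of 0] \<epsilon> R(1) by (simp add: has_vector_derivative_def B linear_0)
  moreover have "\<gamma> t \<in> {y \<in> \<Omega>. f y = 0}" if "t \<in> {-\<epsilon><..<\<epsilon>}" for t
    using \<Phi>g[OF I[OF that]] U' by (auto simp: \<gamma>_def \<Phi>_def U_def)
  moreover have "\<gamma> 0 = x"
    using g0 by (simp add: \<gamma>_def zero_prod_def[symmetric] blinfun.zero_right)
  ultimately show ?thesis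
    unfolding tangent_space_def using \<epsilon>(1) by blast
qed

section \<open>The vertical part and the ratio of Jacobians\<close>

lemma sum_option: "(\<Sum>m\<in>UNIV. F m) = F None + (\<Sum>j\<in>UNIV. F (Some j))"
  for F :: "'j::finite option \<Rightarrow> 'b::comm_monoid_add"
  by (simp add: UNIV_option_conv sum.reindex)

text \<open>
  The frame vector with index \<open>None\<close> is the vertical direction; it is written \<open>Z\<close> in the comments.
\<close>

locale vertical_frame = orthonormal_frame g e
  for g :: "'v::real_vector \<Rightarrow> 'v \<Rightarrow> real" and e :: "'j::finite option \<Rightarrow> 'v"
begin

text \<open>
  The counterpart of \<open>vertical_pvectors\<close> for an abstract frame.
\<close>

definition vertical :: "('p, 'v) pvector set" where
  "vertical = span {wedge (\<lambda>i. if i = l then e None else e (Some (s i))) | l s. True}"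

text \<open>
  After expansion in the frame, a term survives only if \<open>Z\<close> occupies slot \<open>l\<close> and no other slot: these
  are the generators of the vertical multivectors.
\<close>

lemma wedge_vertical:
  fixes h :: "'p::finite \<Rightarrow> 'v"
  assumes h: "\<And>i. g (h i) (e None) = 0"
  shows "wedge (h(l := e None)) \<in> vertical"
proof -
  let ?v = "h(l := e None)"
  have "wedge ?v = wedge (\<lambda>i. \<Sum>m\<in>UNIV. g (?v i) (e m) *\<^sub>R e m)"
    by (simp only: expansion)
  also have "\<dots> = (\<Sum>s\<in>UNIV. (\<Prod>i\<in>UNIV. g (?v i) (e (s i))) *\<^sub>R wedge (e \<circ> s))"
    by (rule wedge_sum_expand)
  also have "\<dots> \<in> vertical"
    unfolding vertical_def
  proof (rule span_sum)
    fix s :: "'p \<Rightarrow> 'j option"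
    show "(\<Prod>i\<in>UNIV. g (?v i) (e (s i))) *\<^sub>R wedge (e \<circ> s) \<in>
        span {wedge (\<lambda>i. if i = l then e None else e (Some (s i))) | l s. True}"
    proof (cases "(\<Prod>i\<in>UNIV. g (?v i) (e (s i))) = 0")
      case True
      then show ?thesis
        by (simp only: scale_zero_left span_zero)
    next
      case False
      then have nz: "g (?v i) (e (s i)) \<noteq> 0" for i
        by simp
      have "s l = None"
        using nz[of l] by (simp add: orthonormal split: if_splits)
      moreover have "s i \<noteq> None" if "i \<noteq> l" for i
        using nz[of i] that h[of i] by (cases "s i") auto
      ultimately have "e \<circ> s = (\<lambda>i. if i = l then e None else e (Some (the (s i))))"
        by (auto simp: fun_eq_iff)
      then show ?thesis
        by (intro span_scale span_base) auto
    qed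
  qed
  finally show ?thesis .
qed

text \<open>
  Against a generator with \<open>Z\<close> in slot \<open>l\<close> the Gram matrix has the zero column \<open>l\<close>.
\<close>

lemma pinner_horizontal_vertical:
  fixes h :: "'p::finite \<Rightarrow> 'v"
  assumes h: "\<And>i. g (h i) (e None) = 0" and "\<zeta> \<in> vertical"
  shows "pinner g (wedge h) \<zeta> = 0"
proof -
  have lin: "linear (pinner g (wedge h))"
    using bilinear_pinner[OF bilinear, where 'p = 'p] by (simp add: bilinear_def)
  have gen: "pinner g (wedge h) (wedge (\<lambda>i. if i = l then e None else e (Some (s i)))) = 0" for l s
    unfolding pinner_wedge[OF bilinear]
    by (rule det_zero_column(1)[of l]) (simp add: column_def vec_eq_iff h)
  show ?thesis
    using assms(2) unfolding vertical_def
    by (induction rule: span_induct) (use gen linear_subspace_kernel[OF lin] in auto)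
qed

text \<open>
  Write \<open>t\<^sub>i = h\<^sub>i + z\<^sub>i Z\<close> with \<open>h\<^sub>i\<close> horizontal. Then \<open>t\<^sub>1 \<and> \<dots> \<and> t\<^sub>p\<close> is the horizontal
  \<open>h\<^sub>1 \<and> \<dots> \<and> h\<^sub>p\<close> plus a vertical \<open>\<eta>\<close>, which is thus the projection, and by Pythagoras
  \<open>|\<eta>|\<^sup>2 = 1 - det (\<delta>\<^sub>i\<^sub>j - z\<^sub>i z\<^sub>j) = \<Sum>\<^sub>i z\<^sub>i\<^sup>2\<close>. The right-hand side of the lemma is the length of the
  projection of \<open>Z\<close> to the span of the \<open>t\<^sub>i\<close>.
\<close>

lemma pnorm_pproj_vertical:
  fixes t :: "'p::finite \<Rightarrow> 'v"
  assumes t: "\<And>i j. g (t i) (t j) = (if i = j then 1 else 0)"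
  shows "pnorm g (pproj g vertical (wedge t)) = sqrt (\<Sum>i\<in>UNIV. (g (t i) (e None))\<^sup>2)"
proof -
  let ?Z = "e None"
  define z where "z i = g (t i) ?Z" for i
  define h where "h i = t i - z i *\<^sub>R ?Z" for i
  define \<eta> where "\<eta> = (\<Sum>l\<in>UNIV. z l *\<^sub>R wedge (h(l := ?Z)))"
  have h: "g (h i) ?Z = 0" for i
    by (simp add: h_def g_simps orthonormal z_def)
  have split: "wedge t = wedge h + \<eta>"
    using wedge_add_multiples[of h z ?Z] by (simp add: h_def \<eta>_def)
  have sub: "subspace vertical"
    by (simp add: vertical_def)
  have \<eta>: "\<eta> \<in> vertical"
    unfolding \<eta>_def by (intro subspace_sum[OF sub] subspace_scale[OF sub] wedge_vertical h)
  have orth: "pinner g (wedge h) \<zeta> = 0" if "\<zeta> \<in> vertical" for \<zeta> :: "('p, 'v) pvector"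
    by (rule pinner_horizontal_vertical[OF h that])
  have proj: "pproj g vertical (wedge t) = \<eta>"
    by (rule pproj_eqI[OF sub \<eta>]) (simp add: split orth)
  have lin: "linear (pinner g \<xi>)" "linear (\<lambda>\<xi>. pinner g \<xi> \<zeta>)" for \<xi> \<zeta> :: "('p, 'v) pvector"
    using bilinear_pinner[OF bilinear, where 'p = 'p] by (simp_all add: bilinear_def)
  have "pinner g \<eta> \<eta> = pinner g (wedge t) \<eta>"
    by (simp add: split linear_add[OF lin(2)] orth[OF \<eta>])
  also have "\<dots> = pinner g (wedge t) (wedge t) - pinner g (wedge t) (wedge h)"
    unfolding linear_diff[OF lin(1), symmetric] by (simp add: split)
  also have "pinner g (wedge t) (wedge t) = 1"
  proof -
    have "(\<chi> i j. g (t i) (t j)) = mat 1"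
      by (simp add: vec_eq_iff mat_def t)
    then show ?thesis
      by (simp only: pinner_wedge[OF bilinear] det_I)
  qed
  also have "pinner g (wedge t) (wedge h) = 1 - (\<Sum>i\<in>UNIV. (z i)\<^sup>2)"
  proof -
    have "g (t i) (h j) = (if i = j then 1 else 0) + (\<chi> i. - z i) $ i * (\<chi> j. z j) $ j" for i j
      by (simp add: h_def g_simps t z_def)
    then have "(\<chi> i j. g (t i) (h j)) = (\<chi> i j. (if i = j then 1 else 0) + (\<chi> i. - z i) $ i * (\<chi> j. z j) $ j)"
      by (simp only:)
    then show ?thesis
      by (simp only: pinner_wedge[OF bilinear] det_mat1_plus_rank_one)
         (simp add: power2_eq_square sum_negf)
  qed
  finally show ?thesis
    by (simp add: pnorm_def proj z_def)
qed

text \<open>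
  Let \<open>G = L L\<^sup>*\<close> be the Gram matrix of \<open>L\<close>. Dropping the column \<open>u = L Z\<close> replaces \<open>G\<close> by
  \<open>G - u u\<^sup>T = G (1 - y u\<^sup>T)\<close>, where \<open>G y = u\<close>; so by the Cauchy-Binet formula the squared ratio of
  the two Jacobians is \<open>1 - \<langle>u, y\<rangle>\<close>. On the other hand \<open>a y = L\<^sup>* y\<close> is orthogonal to the kernel and
  \<open>L (a y) = u\<close>, so \<open>w = Z - a y\<close> is the projection of \<open>Z\<close> to the kernel, and
  \<open>|w|\<^sup>2 = g(Z, w) = 1 - \<langle>u, y\<rangle>\<close> as well.
\<close>

lemma minors_norm_ratio:
  fixes L :: "'v \<Rightarrow> real^'k::finite" and t :: "'p::finite \<Rightarrow> 'v"
  assumes L: "linear L" "surj L" and t: "orthonormal_basis g t {v. L v = 0}"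
  shows "minors_norm L (\<lambda>j. e (Some j)) / minors_norm L e = sqrt (\<Sum>i\<in>UNIV. (g (t i) (e None))\<^sup>2)"
proof -
  let ?Z = "e None"
  define G :: "real^'k^'k" where "G = (\<chi> i j. \<Sum>m\<in>UNIV. L (e m) $ i * L (e m) $ j)"
  \<comment> \<open>\<open>a\<close> is the adjoint of \<open>L\<close> with respect to \<open>g\<close> and the standard inner product.\<close>
  define a where "a y = (\<Sum>m\<in>UNIV. (L (e m) \<bullet> y) *\<^sub>R e m)" for y
  have a: "g v (a y) = L v \<bullet> y" for v y
  proof -
    have "L v = (\<Sum>m\<in>UNIV. g v (e m) *\<^sub>R L (e m))"
      by (simp add: linear_sum[OF L(1), symmetric] linear_scale[OF L(1), symmetric] expansion)
    then show ?thesis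
      by (simp add: a_def g_simps inner_sum_left mult.commute)
  qed
  have La: "L (a y) = G *v y" for y
  proof -
    have "(G *v y) $ i = (\<Sum>j\<in>UNIV. \<Sum>m\<in>UNIV. L (e m) $ i * L (e m) $ j * y $ j)" for i
      by (simp add: G_def matrix_vector_mult_def sum_distrib_right)
    also have "\<dots> i = (\<Sum>m\<in>UNIV. (L (e m) \<bullet> y) * L (e m) $ i)" for i
      by (subst sum.swap) (simp add: inner_vec_def sum_distrib_left mult_ac)
    finally show ?thesis
      by (simp add: a_def linear_sum[OF L(1)] linear_scale[OF L(1)] vec_eq_iff)
  qed
  have "y = 0" if "G *v y = 0" for y
  proof -
    have "g (a y) (a y) = 0"
      by (simp add: a La that)
    then have "a y = 0"
      by (rule definite)
    then have "L v \<bullet> y = 0" for v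
      using a[of v y] by (simp add: g_simps)
    moreover obtain v where "y = L v"
      using L(2) by (rule surjE)
    ultimately have "y \<bullet> y = 0"
      by simp
    then show "y = 0"
      by simp
  qed
  then have inv: "invertible G"
    by (simp add: invertible_left_inverse matrix_left_invertible_ker)
  then obtain G' where "G ** G' = mat 1"
    by (auto simp: invertible_def)
  then have "G *v (G' *v L ?Z) = L ?Z"
    by (simp add: matrix_vector_mul_assoc)
  then obtain y where y: "G *v y = L ?Z" ..
  define w where "w = ?Z - a y"
  have sq: "(\<Sum>i\<in>UNIV. (g (t i) ?Z)\<^sup>2) = 1 - L ?Z \<bullet> y"
  proof -
    have tt: "g (t i) (t j) = (if i = j then 1 else 0)" for i j
      using t by (simp add: orthonormal_basis_def)
    have Lt: "L (t i) = 0" for i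
      using t span_base[of "t i" "range t"] by (auto simp: orthonormal_basis_def)
    have "L w = 0"
      by (simp add: w_def linear_diff[OF L(1)] La y)
    then have "w \<in> span (range t)"
      using t by (simp add: orthonormal_basis_def)
    then have "g w w = (\<Sum>i\<in>UNIV. (g (t i) w)\<^sup>2)"
      using parseval_span[OF tt, of w w] by (simp only: power2_eq_square)
    also have "\<dots> = (\<Sum>i\<in>UNIV. (g (t i) ?Z)\<^sup>2)"
      by (simp add: w_def g_simps a Lt)
    also have "g w w = 1 - L ?Z \<bullet> y"
    proof -
      have "g w w = g ?Z w - g (a y) w"
        by (simp add: w_def g_simps)
      also have "g (a y) w = 0"
        by (simp add: sym[of "a y"] a \<open>L w = 0\<close>)
      also have "g ?Z w = 1 - L ?Z \<bullet> y"
        by (simp add: w_def g_simps orthonormal a)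
      finally show ?thesis by simp
    qed
    finally show ?thesis ..
  qed
  have "(\<chi> i j. \<Sum>m\<in>UNIV. L (e (Some m)) $ i * L (e (Some m)) $ j) =
      G ** (\<chi> i j. (if i = j then 1 else 0) + (- y) $ i * L ?Z $ j)" (is "_ = _ ** ?M")
  proof -
    have "(\<Sum>m\<in>UNIV. L (e (Some m)) $ i * L (e (Some m)) $ j) = G $ i $ j - L ?Z $ i * L ?Z $ j" for i j
      by (simp add: G_def sum_option)
    moreover have "(G ** ?M) $ i $ j = G $ i $ j - (G *v y) $ i * L ?Z $ j" for i j
    proof -
      have "G $ i $ k * ((if k = j then 1 else 0) + (- y) $ k * L ?Z $ j) =
          (if k = j then G $ i $ k else 0) - G $ i $ k * y $ k * L ?Z $ j" for k
        by (simp add: algebra_simps)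
      then show ?thesis
        by (simp add: matrix_matrix_mult_def matrix_vector_mult_def sum_subtractf sum_distrib_right)
    qed
    ultimately show ?thesis
      by (simp add: vec_eq_iff y)
  qed
  then have "minors_norm L (\<lambda>j. e (Some j)) = sqrt (det G * (1 - L ?Z \<bullet> y))"
    by (simp only: Cauchy_Binet det_mul det_mat1_plus_rank_one)
       (simp add: inner_vec_def sum_negf mult.commute)
  moreover have "minors_norm L e = sqrt (det G)"
    by (simp add: Cauchy_Binet G_def)
  moreover have "det G \<noteq> 0"
    using inv by (simp add: invertible_det_nz)
  ultimately show ?thesis
    by (simp add: sq real_sqrt_mult)
qed

end

section \<open>The Heisenberg group\<close>

lemma vertical_frame_heis: "vertical_frame (heis_metric x) (\<lambda>m. heis_frame m x)"
proof
  show "bilinear (heis_metric x)"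
    by (simp add: bilinear_def linear_iff heis_metric_eq inner_simps algebra_simps)
  show "heis_metric x v w = heis_metric x w v" for v w
    by (simp add: heis_metric_eq inner_commute mult.commute)
  show "heis_metric x (heis_frame i x) (heis_frame j x) = (if i = j then 1 else 0)" for i j
    by (rule heis_metric_frame)
  show "(\<Sum>m\<in>UNIV. heis_metric x v (heis_frame m x) *\<^sub>R heis_frame m x) = v" for v
  proof -
    obtain p q r a b c where x: "x = (p, q, r)" and v: "v = (a, b, c)"
      by (metis prod_cases3)
    have basis: "(\<Sum>k\<in>UNIV. u $ k *\<^sub>R axis k 1) = u" for u :: "real^'a"
      using basis_expansion[of u] by (simp add: scalar_mult_eq_scaleR)
    have "heis_metric x v (hor_field (Inl k) x) = a $ k" "heis_metric x v (hor_field (Inr k) x) = b $ k"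
      "heis_metric x v (Z_field x) = c - (p \<bullet> b - q \<bullet> a)" for k
      by (simp_all add: heis_metric_eq x v hor_field_Inl hor_field_Inr Z_field inner_axis)
    then have "(\<Sum>m\<in>UNIV. heis_metric x v (heis_frame m x) *\<^sub>R heis_frame m x) =
        (c - (p \<bullet> b - q \<bullet> a)) *\<^sub>R Z_field x +
        ((\<Sum>k\<in>UNIV. a $ k *\<^sub>R hor_field (Inl k) x) + (\<Sum>k\<in>UNIV. b $ k *\<^sub>R hor_field (Inr k) x))"
      by (simp add: sum_option heis_frame_def UNIV_Plus_UNIV[symmetric] sum.Plus del: UNIV_Plus_UNIV)
    also have "\<dots> = v"
      by (rule prod_eqI, simp_all add: fst_sum snd_sum x v hor_field_Inl hor_field_Inr Z_field basis,
          rule prod_eqI)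
        (simp_all add: fst_sum snd_sum basis inner_vec_def sum_negf mult.commute)
    finally show ?thesis .
  qed
qed

theorem theorem3p3:
  fixes \<Omega> :: "'n::finite heis set"
    and f :: "'n heis \<Rightarrow> real^'k::finite"
    and x :: "'n heis"
  assumes "1 \<le> CARD('k)" and "CARD('k) \<le> 2 * CARD('n)"
    and "CARD('p::finite) = 2 * CARD('n) + 1 - CARD('k)"
    and "open \<Omega>"
    and "C1_on f \<Omega>"
    and "\<forall>y\<in>\<Omega>. surj (frechet_derivative f (at y))"
    and "S = {y \<in> \<Omega>. f y = 0}"
    and "x \<in> S"
  shows "(\<exists>\<tau> :: ('p, 'n heis) pvector. tangent_pvector S x \<tau>) \<and>
    (\<forall>\<tau> :: ('p, 'n heis) pvector. tangent_pvector S x \<tau> \<longrightarrow>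
       pnorm (heis_metric x) (proj_vertical x \<tau>) = jacobian_H f x / jacobian_g f x)"
proof -
  interpret vertical_frame "heis_metric x" "\<lambda>m. heis_frame m x"
    by (rule vertical_frame_heis)
  let ?L = "frechet_derivative f (at x)"
  have x: "x \<in> \<Omega>" "f x = 0"
    using assms(7,8) by auto
  have tangent: "tangent_space S x = {v. ?L v = 0}"
    unfolding assms(7)
    using tangent_space_level_set_subset[OF assms(5)]
      kernel_subset_tangent_space_level_set[OF assms(4,5) x] assms(6) x by blast
  have "f differentiable (at x)"
    using assms(5) x by (auto simp: C1_on_def differentiable_def)
  then have L: "linear ?L" "surj ?L"
    using assms(6) x linear_frechet_derivative by auto
  have "CARD('p) + CARD('k) = CARD(('n + 'n) option)"
    using assms(2,3) by simp
  then obtain t :: "'p \<Rightarrow> 'n heis" where "orthonormal_basis (heis_metric x) t {v. ?L v = 0}"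
    using ex_orthonormal_basis_kernel[OF L] by blast
  then have "tangent_pvector S x (wedge t)"
    by (auto simp: tangent_pvector_def tangent)
  moreover have "pnorm (heis_metric x) (proj_vertical x \<tau>) = jacobian_H f x / jacobian_g f x"
    if \<tau>: "tangent_pvector S x \<tau>" for \<tau> :: "('p, 'n heis) pvector"
  proof -
    obtain t where t: "orthonormal_basis (heis_metric x) t {v. ?L v = 0}" and "\<tau> = wedge t"
      using \<tau> by (auto simp: tangent_pvector_def tangent)
    have "heis_frame None = (Z_field :: 'n heis \<Rightarrow> 'n heis)" "heis_frame (Some j) = hor_field j" for j :: "'n + 'n"
      by (simp_all add: heis_frame_def)
    then have "vertical_pvectors x = (vertical :: ('p, 'n heis) pvector set)"
      by (simp only: vertical_pvectors_def vertical_def)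
    then have "pnorm (heis_metric x) (proj_vertical x \<tau>) =
        sqrt (\<Sum>i\<in>UNIV. (heis_metric x (t i) (heis_frame None x))\<^sup>2)"
      unfolding proj_vertical_def \<open>\<tau> = wedge t\<close>
      using t by (simp only:) (rule pnorm_pproj_vertical, simp add: orthonormal_basis_def)
    also have "\<dots> = jacobian_H f x / jacobian_g f x"
      using minors_norm_ratio[OF L t]
      by (simp add: jacobian_H_def jacobian_g_def heis_frame_def)
    finally show ?thesis .
  qed
  ultimately show ?thesis by blast
qed

end
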